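(* Let $r\ge r_P$ and $\bar u\in L^2(\mathbb{R})$ be given. Then $\bar u$ is a local solution of (P) with radius of optimality $\rho$ if and only if the following two conditions are satisfied: (i) It holds $\bar u=\max\left(0,u_D-\frac{\nu_1}{\nu_2}\right)$ a.e. in $\mathbb{R}\setminus(-r,r)$. (ii) The restriction $\bar{\mathsf u}:=\bar u|_{(-r,r)}\in L^2(-r,r)$ is a local solution with radius of optimality $\rho$ of the problem (P$_r$): $$\text{minimize } F_r(\mathsf u)=\frac12\|S_r(\mathsf u)-y_D\|_{L^2(\Omega)}^2+\int_{-r}^r \nu_1\mathsf u+\frac{\nu_2}{2}(\mathsf u-\mathsf u_D)^2\,dt\quad\text{w.r.t. } \mathsf u\in L^2(-r,r),\ \mathsf u\ge 0 \text{ a.e. in }(-r,r).$$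
   Context: Standing assumptions: $d\in\{1,2,3\}$; $\Omega\subset\mathbb{R}^d$ is a bounded domain that is convex or of class $C^{1,1}$; $y_D\in L^2(\Omega)$ and $u_D\in L^2(\mathbb{R})$ are given; $\nu_1\ge 0$ and $\nu_2>0$; $f\in L^2(\Omega)$ is not identically zero. For $u\in L^1_{loc}(\mathbb{R})$ set $g_u(t):=\int_0^t u(s)\,ds$, $t\in\mathbb{R}$ (with $\int_0^t u\,ds:=-\int_t^0 u\,ds$ for $t<0$); $g_u$ also denotes the induced Nemytskii operator. For every $0\le u\in L^2(\mathbb{R})$ the equation $-\Delta y+g_u(y)=f$ in $\Omega$, $y=0$ on $\partial\Omega$, has a unique weak solution $y=:S(u)\in H_0^1(\Omega)\cap H^2(\Omega)$. Let $y_P\in H_0^1(\Omega)\cap H^2(\Omega)\subset C(\overline\Omega)$ solve $-\Delta y_P=f$ in $\Omega$, $y_P=0$ on $\partial\Omega$, and $r_P:=2\|y_P\|_\infty>0$. Problem (P): minimize $J(S(u),u)$ over all $u\in L^2(\mathbb{R})$ with $u\ge 0$ a.e. in $\mathbb{R}$, where $J(y,u):=\frac12\|y-y_D\|_{L^2(\Omega)}^2+\nu_1\|u\|_{L^1(\mathbb{R})}+\frac{\nu_2}{2}\|u-u_D\|_{L^2(\mathbb{R})}^2\in[0,\infty]$ (the $L^1$-term is $0$ if $\nu_1=0$). A function $0\le\bar u\in L^2(\mathbb{R})$ is a local solution of (P) with radius of optimality $\rho>0$ if $J(S(u),u)\ge J(S(\bar u),\bar u)$ for all $0\le u\in L^2(\mathbb{R})$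 with $\|u-\bar u\|_{L^2(\mathbb{R})}\le\rho$ ($\rho=\infty$ is allowed and corresponds to global solutions). For $r>0$: $\mathsf u_D:=u_D|_{(-r,r)}$; $E_r\colon L^2(-r,r)\to L^2(\mathbb{R})$ is extension by zero; $S_r(\mathsf u):=S(E_r(\mathsf u))$. A function $0\le\bar{\mathsf u}\in L^2(-r,r)$ is a local solution of (P$_r$) with radius of optimality $\rho$ if $F_r(\mathsf u)\ge F_r(\bar{\mathsf u})$ for all $0\le\mathsf u\in L^2(-r,r)$ with $\|\mathsf u-\bar{\mathsf u}\|_{L^2(-r,r)}\le\rho$. *)

theory Defs
  imports "HOL-Analysis.Analysis" "HOL-Probability.Essential_Supremum"
begin

section \<open>Square integrable functions\<close>

text \<open>Elements of \<open>L\<^sup>2\<close> are represented by functions, and equality in \<open>L\<^sup>2\<close> is equality almost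
  everywhere. For \<open>M = lebesgue_on A\<close> the values of the representative outside of \<open>A\<close> play no
  role, so the restriction of a function to \<open>A\<close> is represented by the function itself.\<close>

definition L2 :: "'a measure \<Rightarrow> ('a \<Rightarrow> 'b::euclidean_space) set" where
  "L2 M = {f \<in> borel_measurable M. integrable M (\<lambda>x. (norm (f x))\<^sup>2)}"

definition L2norm :: "'a measure \<Rightarrow> ('a \<Rightarrow> 'b::euclidean_space) \<Rightarrow> real" where
  "L2norm M f = sqrt (LINT x|M. (norm (f x))\<^sup>2)"


section \<open>Test functions and Sobolev spaces\<close>

primrec Ck :: "nat \<Rightarrow> (real ^ 'd::finite \<Rightarrow> real) \<Rightarrow> bool" where
  "Ck 0 \<phi> \<longleftrightarrow> continuous_on UNIV \<phi>"
| "Ck (Suc k) \<phi> \<longleftrightarrow> (\<exists>g. (\<forall>x. GDERIV \<phi> x :> g x) \<and> (\<forall>i. Ck k (\<lambda>x. g x $ i)))"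

definition grad :: "(real ^ 'd::finite \<Rightarrow> real) \<Rightarrow> real ^ 'd \<Rightarrow> real ^ 'd" where
  "grad \<phi> x = (THE g. GDERIV \<phi> x :> g)"

definition test_functions :: "(real ^ 'd::finite) set \<Rightarrow> (real ^ 'd \<Rightarrow> real) set" where
  "test_functions \<Omega> = {\<phi>. (\<forall>k. Ck k \<phi>) \<and>
     compact (closure {x. \<phi> x \<noteq> 0}) \<and> closure {x. \<phi> x \<noteq> 0} \<subseteq> \<Omega>}"

text \<open>\<open>has_weak_gradient \<Omega> y G\<close>: \<open>y \<in> H\<^sup>1(\<Omega>)\<close> and \<open>G \<in> L\<^sup>2(\<Omega>)\<^sup>d\<close> is its weak gradient.\<close>

definition has_weak_gradient ::
  "(real ^ 'd::finite) set \<Rightarrow> (real ^ 'd \<Rightarrow> real) \<Rightarrow> (real ^ 'd \<Rightarrow> real ^ 'd) \<Rightarrow> bool" where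
  "has_weak_gradient \<Omega> y G \<longleftrightarrow> y \<in> L2 (lebesgue_on \<Omega>) \<and> G \<in> L2 (lebesgue_on \<Omega>) \<and>
     (\<forall>\<phi>\<in>test_functions \<Omega>.
        (LINT x|lebesgue_on \<Omega>. y x *\<^sub>R grad \<phi> x) = - (LINT x|lebesgue_on \<Omega>. \<phi> x *\<^sub>R G x))"

definition H1 :: "(real ^ 'd::finite) set \<Rightarrow> (real ^ 'd \<Rightarrow> real) set" where
  "H1 \<Omega> = {y. \<exists>G. has_weak_gradient \<Omega> y G}"

definition H2 :: "(real ^ 'd::finite) set \<Rightarrow> (real ^ 'd \<Rightarrow> real) set" where
  "H2 \<Omega> = {y. \<exists>G. has_weak_gradient \<Omega> y G \<and> (\<forall>i. (\<lambda>x. G x $ i) \<in> H1 \<Omega>)}"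

text \<open>The closure of the test functions in \<open>H\<^sup>1(\<Omega>)\<close>:\<close>

definition H10 :: "(real ^ 'd::finite) set \<Rightarrow> (real ^ 'd \<Rightarrow> real) set" where
  "H10 \<Omega> = {y. \<exists>G. has_weak_gradient \<Omega> y G \<and>
     (\<exists>\<phi>. (\<forall>n::nat. \<phi> n \<in> test_functions \<Omega>) \<and>
        (\<lambda>n. L2norm (lebesgue_on \<Omega>) (\<lambda>x. \<phi> n x - y x)) \<longlonglongrightarrow> 0 \<and>
        (\<lambda>n. L2norm (lebesgue_on \<Omega>) (\<lambda>x. grad (\<phi> n) x - G x)) \<longlonglongrightarrow> 0)}"


section \<open>Domains\<close>

definition bounded_domain :: "(real ^ 'd::finite) set \<Rightarrow> bool" where
  "bounded_domain \<Omega> \<longleftrightarrow> \<Omega> \<noteq> {} \<and> open \<Omega> \<and> connected \<Omega> \<and> bounded \<Omega>"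

text \<open>Near each boundary point, \<open>\<Omega>\<close> is the strict subgraph, in some direction \<open>e\<close>, of a
  function \<open>\<gamma>\<close> with Lipschitz continuous gradient. A function on the hyperplane orthogonal
  to \<open>e\<close> is written as a function on the whole space which is constant in direction \<open>e\<close>.\<close>

definition C11_boundary :: "(real ^ 'd::finite) set \<Rightarrow> bool" where
  "C11_boundary \<Omega> \<longleftrightarrow> (\<forall>x0\<in>frontier \<Omega>. \<exists>\<delta>>0. \<exists>e \<gamma> D L.
     norm e = 1 \<and> (\<forall>x t. \<gamma> (x + t *\<^sub>R e) = \<gamma> x) \<and>
     (\<forall>x. GDERIV \<gamma> x :> D x) \<and> L-lipschitz_on UNIV D \<and>
     \<Omega> \<inter> ball x0 \<delta> = {x \<in> ball x0 \<delta>. x \<bullet> e < \<gamma> x})"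


section \<open>The state equation\<close>

definition nemytskii :: "(real \<Rightarrow> real) \<Rightarrow> real \<Rightarrow> real" where
  "nemytskii u t = (LINT s=0..ereal t|lebesgue. u s)"

text \<open>Weak solutions of \<open>- \<Delta>y + g(y) = f\<close> in \<open>\<Omega>\<close>, \<open>y = 0\<close> on the boundary. Weak gradients are
  unique up to null sets, and exist for elements of \<open>H10 \<Omega>\<close>, so quantifying over all of them
  just names \<open>\<nabla>y\<close> and \<open>\<nabla>v\<close>.\<close>

definition weak_solution ::
  "(real ^ 'd::finite) set \<Rightarrow> (real \<Rightarrow> real) \<Rightarrow> (real ^ 'd \<Rightarrow> real) \<Rightarrow> (real ^ 'd \<Rightarrow> real) \<Rightarrow> bool" where
  "weak_solution \<Omega> g f y \<longleftrightarrow> y \<in> H10 \<Omega> \<and>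
     (\<forall>v\<in>H10 \<Omega>. \<forall>G V. has_weak_gradient \<Omega> y G \<longrightarrow> has_weak_gradient \<Omega> v V \<longrightarrow>
        (LINT x|lebesgue_on \<Omega>. G x \<bullet> V x) + (LINT x|lebesgue_on \<Omega>. g (y x) * v x)
          = (LINT x|lebesgue_on \<Omega>. f x * v x))"

text \<open>The solution operator \<open>S\<close>. The solution is unique in \<open>L\<^sup>2(\<Omega>)\<close>; the choice
  operator only selects a representative.\<close>

definition state :: "(real ^ 'd::finite) set \<Rightarrow> (real ^ 'd \<Rightarrow> real) \<Rightarrow> (real \<Rightarrow> real) \<Rightarrow> real ^ 'd \<Rightarrow> real" where
  "state \<Omega> f u = (SOME y. y \<in> H2 \<Omega> \<and> weak_solution \<Omega> (nemytskii u) f y)"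


section \<open>The problem on the real line\<close>

text \<open>In \<open>ennreal\<close> we have \<open>0 * \<infinity> = 0\<close>, so the \<open>L\<^sup>1\<close>-term vanishes for \<open>\<nu>1 = 0\<close>.\<close>

definition objective ::
  "(real ^ 'd::finite) set \<Rightarrow> (real ^ 'd \<Rightarrow> real) \<Rightarrow> (real \<Rightarrow> real) \<Rightarrow> real \<Rightarrow> real \<Rightarrow>
    (real ^ 'd \<Rightarrow> real) \<Rightarrow> (real \<Rightarrow> real) \<Rightarrow> ennreal" where
  "objective \<Omega> y\<^sub>D u\<^sub>D \<nu>1 \<nu>2 y u =
     ennreal (1 / 2 * (L2norm (lebesgue_on \<Omega>) (\<lambda>x. y x - y\<^sub>D x))\<^sup>2)
     + ennreal \<nu>1 * (\<integral>\<^sup>+ t. ennreal \<bar>u t\<bar> \<partial>lebesgue)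
     + ennreal (\<nu>2 / 2 * (L2norm lebesgue (\<lambda>t. u t - u\<^sub>D t))\<^sup>2)"

definition local_solution_P ::
  "(real ^ 'd::finite) set \<Rightarrow> (real ^ 'd \<Rightarrow> real) \<Rightarrow> (real ^ 'd \<Rightarrow> real) \<Rightarrow> (real \<Rightarrow> real) \<Rightarrow> real \<Rightarrow> real \<Rightarrow>
    ereal \<Rightarrow> (real \<Rightarrow> real) \<Rightarrow> bool" where
  "local_solution_P \<Omega> f y\<^sub>D u\<^sub>D \<nu>1 \<nu>2 \<rho> ubar \<longleftrightarrow>
     ubar \<in> L2 lebesgue \<and> (AE t in lebesgue. 0 \<le> ubar t) \<and>
     (\<forall>u\<in>L2 lebesgue. (AE t in lebesgue. 0 \<le> u t) \<longrightarrow>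
        ereal (L2norm lebesgue (\<lambda>t. u t - ubar t)) \<le> \<rho> \<longrightarrow>
        objective \<Omega> y\<^sub>D u\<^sub>D \<nu>1 \<nu>2 (state \<Omega> f u) u \<ge> objective \<Omega> y\<^sub>D u\<^sub>D \<nu>1 \<nu>2 (state \<Omega> f ubar) ubar)"


section \<open>The problem on a bounded interval\<close>

definition ext0 :: "real \<Rightarrow> (real \<Rightarrow> real) \<Rightarrow> real \<Rightarrow> real" where
  "ext0 r u t = (if t \<in> {-r<..<r} then u t else 0)"

definition state_r ::
  "(real ^ 'd::finite) set \<Rightarrow> (real ^ 'd \<Rightarrow> real) \<Rightarrow> real \<Rightarrow> (real \<Rightarrow> real) \<Rightarrow> real ^ 'd \<Rightarrow> real" where
  "state_r \<Omega> f r u = state \<Omega> f (ext0 r u)"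

definition objective_r ::
  "(real ^ 'd::finite) set \<Rightarrow> (real ^ 'd \<Rightarrow> real) \<Rightarrow> (real ^ 'd \<Rightarrow> real) \<Rightarrow> (real \<Rightarrow> real) \<Rightarrow> real \<Rightarrow> real \<Rightarrow>
    real \<Rightarrow> (real \<Rightarrow> real) \<Rightarrow> real" where
  "objective_r \<Omega> f y\<^sub>D u\<^sub>D \<nu>1 \<nu>2 r u =
     1 / 2 * (L2norm (lebesgue_on \<Omega>) (\<lambda>x. state_r \<Omega> f r u x - y\<^sub>D x))\<^sup>2
     + (LINT t|lebesgue_on {-r<..<r}. \<nu>1 * u t + \<nu>2 / 2 * (u t - u\<^sub>D t)\<^sup>2)"

definition local_solution_P_r ::
  "(real ^ 'd::finite) set \<Rightarrow> (real ^ 'd \<Rightarrow> real) \<Rightarrow> (real ^ 'd \<Rightarrow> real) \<Rightarrow> (real \<Rightarrow> real) \<Rightarrow> real \<Rightarrow> real \<Rightarrow>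
    real \<Rightarrow> ereal \<Rightarrow> (real \<Rightarrow> real) \<Rightarrow> bool" where
  "local_solution_P_r \<Omega> f y\<^sub>D u\<^sub>D \<nu>1 \<nu>2 r \<rho> ubar \<longleftrightarrow>
     ubar \<in> L2 (lebesgue_on {-r<..<r}) \<and> (AE t in lebesgue_on {-r<..<r}. 0 \<le> ubar t) \<and>
     (\<forall>u\<in>L2 (lebesgue_on {-r<..<r}). (AE t in lebesgue_on {-r<..<r}. 0 \<le> u t) \<longrightarrow>
        ereal (L2norm (lebesgue_on {-r<..<r}) (\<lambda>t. u t - ubar t)) \<le> \<rho> \<longrightarrow>
        objective_r \<Omega> f y\<^sub>D u\<^sub>D \<nu>1 \<nu>2 r u \<ge> objective_r \<Omega> f y\<^sub>D u\<^sub>D \<nu>1 \<nu>2 r ubar)"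

end

theory Submission
  imports Defs "HOL-Computational_Algebra.Polynomial"
begin

text \<open>
  A control \<open>u\<close> enters the state equation only through \<open>g\<^sub>u(y)\<close>, so only the values of \<open>u\<close> on the
  range of the state matter, and this range lies in \<open>[-r, r]\<close>. Indeed, if \<open>y\<close> is a state
  and \<open>M = r / 2\<close> bounds \<open>\<bar>y\<^sub>P\<bar>\<close>, then \<open>w = y - y\<^sub>P\<close> solves \<open>-\<Delta>w + g\<^sub>u(y) = 0\<close>. Where
  \<open>w > M\<close> we have \<open>y = w + y\<^sub>P > 0\<close> and hence \<open>g\<^sub>u(y) \<ge> 0\<close>, so testing with the positive part of
  \<open>w - M\<close> gives \<open>w \<le> M\<close>; with the same for \<open>-w\<close> this yields \<open>\<bar>y\<bar> \<le> 2 * M\<close>. These are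
  \<open>weak_maximum_principle\<close> and \<open>weak_solution_bound\<close>. Consequently two nonnegative controls that
  agree on \<open>(-r, r)\<close> have the same weak solutions, and \<open>state_cong\<close> follows because the state
  is selected from the set of weak solutions.

  The function spaces are given as closures of test functions, so the test function
  above has to be approximated. The positive part of \<open>w - M\<close> is replaced by softplus functions of
  \<open>w\<close>; all their derivatives are polynomials in the logistic function, so they map test functions
  to test functions, and \<open>H10_gradient_compose\<close> is the chain rule for them. The estimate is closed by
  a Poincare inequality, obtained by testing the weak gradient of \<open>y\<close> with
  \<open>x\<^sub>i * \<phi>\<^sub>n\<close>, where \<open>\<phi>\<^sub>n\<close> approximates \<open>y\<close>.

  Since the state is a function of \<open>u\<close> on \<open>(-r, r)\<close>, the objective splits into \<open>F\<^sub>r\<close>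
  and the cost of the tail of \<open>u\<close> (\<open>J_split\<close>). The tail cost is an integral of a strongly convex
  function of \<open>u(t)\<close>, minimised pointwise over \<open>[0, \<infinity>)\<close> by \<open>max(0, u\<^sub>D(t) - \<nu>1 / \<nu>2)\<close>. So the two
  conditions imply local optimality by adding two inequalities. For the converse, the tail of a local
  solution is moved towards the pointwise minimiser within the radius of optimality, which strictly lowers the
  integrand where the two differ. The moved control is chosen with finite tail cost, because the
  comparison of two infinite objectives would say nothing (\<open>tail_of_local_solution\<close>). Once the tail is known, it cancels from both
  sides of the optimality condition, which leaves the problem on the interval.
\<close>

section \<open>Square integrable functions\<close>

lemma L2_D:
  assumes "f \<in> L2 M"
  shows "f \<in> borel_measurable M" "integrable M (\<lambda>x. (norm (f x))\<^sup>2)"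
  using assms by (auto simp: L2_def)

lemma L2_dominated:
  fixes f :: "'a \<Rightarrow> 'b::euclidean_space" and g :: "'a \<Rightarrow> real"
  assumes "f \<in> borel_measurable M" "integrable M g" "AE x in M. (norm (f x))\<^sup>2 \<le> g x"
  shows "f \<in> L2 M"
proof -
  have "integrable M (\<lambda>x. (norm (f x))\<^sup>2)"
    by (rule Bochner_Integration.integrable_bound[OF assms(2)]) (use assms in auto)
  then show ?thesis using assms(1) by (simp add: L2_def)
qed

lemma norm_add_sq_le: "(norm (a + b))\<^sup>2 \<le> 2 * (norm a)\<^sup>2 + 2 * (norm (b::'b::real_normed_vector))\<^sup>2"
proof -
  have "(norm (a + b))\<^sup>2 \<le> (norm a + norm b)\<^sup>2"
    by (intro power_mono norm_triangle_ineq) auto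
  also have "\<dots> \<le> 2 * (norm a)\<^sup>2 + 2 * (norm b)\<^sup>2"
    using sum_squares_bound[of "norm a" "norm b"] by (simp add: power2_sum)
  finally show ?thesis .
qed

lemma L2_add: "f \<in> L2 M \<Longrightarrow> g \<in> L2 M \<Longrightarrow> (\<lambda>x. f x + g x) \<in> L2 M"
  by (rule L2_dominated[where g = "\<lambda>x. 2 * (norm (f x))\<^sup>2 + 2 * (norm (g x))\<^sup>2"])
    (auto simp: L2_def norm_add_sq_le)

lemma L2_uminus: "f \<in> L2 M \<Longrightarrow> (\<lambda>x. - f x) \<in> L2 M"
  by (auto simp: L2_def)

lemma L2_diff: "f \<in> L2 M \<Longrightarrow> g \<in> L2 M \<Longrightarrow> (\<lambda>x. f x - g x) \<in> L2 M"
  using L2_add[OF _ L2_uminus, of f M g] by simp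

lemma L2_scaleR_bounded:
  assumes "f \<in> L2 M" "c \<in> borel_measurable M" "AE x in M. \<bar>c x\<bar> \<le> C"
  shows "(\<lambda>x. c x *\<^sub>R f x) \<in> L2 M"
proof (rule L2_dominated[where g = "\<lambda>x. C\<^sup>2 * (norm (f x))\<^sup>2"])
  show "AE x in M. (norm (c x *\<^sub>R f x))\<^sup>2 \<le> C\<^sup>2 * (norm (f x))\<^sup>2"
    using assms(3)
  proof eventually_elim
    case (elim x)
    have "(c x)\<^sup>2 \<le> C\<^sup>2" using power_mono[OF elim abs_ge_zero, of 2] by simp
    then show ?case by (simp add: power_mult_distrib mult_right_mono)
  qed
qed (use assms in \<open>auto simp: L2_def\<close>)

lemma L2_nth:
  fixes F :: "'a \<Rightarrow> real ^ 'd::finite"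
  assumes "F \<in> L2 M"
  shows "(\<lambda>x. F x $ i) \<in> L2 M"
proof (rule L2_dominated[where g = "\<lambda>x. (norm (F x))\<^sup>2"])
  show "(\<lambda>x. F x $ i) \<in> borel_measurable M"
    using measurable_compose[OF L2_D(1)[OF assms], of "\<lambda>v. v $ i"]
    by (simp add: borel_measurable_continuous_onI continuous_on_component)
  show "AE x in M. (norm (F x $ i))\<^sup>2 \<le> (norm (F x))\<^sup>2"
    by (intro AE_I2 power_mono) (auto simp: component_le_norm_cart)
qed (use assms in \<open>auto simp: L2_def\<close>)

lemma L2_inner_integrable:
  assumes "f \<in> L2 M" "g \<in> L2 M"
  shows "integrable M (\<lambda>x. f x \<bullet> g x)"
proof (rule Bochner_Integration.integrable_bound[where f = "\<lambda>x. (norm (f x))\<^sup>2 + (norm (g x))\<^sup>2"])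
  show "AE x in M. norm (f x \<bullet> g x) \<le> norm ((norm (f x))\<^sup>2 + (norm (g x))\<^sup>2)"
  proof (rule AE_I2)
    fix x
    have "\<bar>f x \<bullet> g x\<bar> \<le> norm (f x) * norm (g x)" by (rule Cauchy_Schwarz_ineq2)
    also have "\<dots> \<le> (norm (f x))\<^sup>2 + (norm (g x))\<^sup>2"
    proof -
      have "0 \<le> norm (f x) * norm (g x)" by simp
      then show ?thesis using sum_squares_bound[of "norm (f x)" "norm (g x)"] by linarith
    qed
    finally show "norm (f x \<bullet> g x) \<le> norm ((norm (f x))\<^sup>2 + (norm (g x))\<^sup>2)" by simp
  qed
qed (use assms in \<open>auto simp: L2_def\<close>)

lemma L2_mult_integrable:
  fixes f g :: "'a \<Rightarrow> real"
  assumes "f \<in> L2 M" "g \<in> L2 M"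
  shows "integrable M (\<lambda>x. f x * g x)"
  using L2_inner_integrable[OF assms] by simp

lemma L2norm_sq: "(L2norm M f)\<^sup>2 = (LINT x|M. (norm (f x))\<^sup>2)"
  by (simp add: L2norm_def)

lemma L2norm_nonneg: "0 \<le> L2norm M f"
  by (simp add: L2norm_def)

text \<open>The Cauchy-Schwarz inequality, from the nonnegative quadratic form
  \<open>\<integral> \<bar>t * f + s * g\<bar>\<^sup>2\<close> in \<open>(t, s)\<close>.\<close>

lemma L2_inner_le:
  assumes f: "f \<in> L2 M" and g: "g \<in> L2 M"
  shows "\<bar>LINT x|M. f x \<bullet> g x\<bar> \<le> L2norm M f * L2norm M g"
proof -
  let ?a = "LINT x|M. (norm (f x))\<^sup>2" and ?b = "LINT x|M. f x \<bullet> g x"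
    and ?c = "LINT x|M. (norm (g x))\<^sup>2"
  note int = L2_D(2)[OF f] L2_D(2)[OF g] L2_inner_integrable[OF f g]
  have nonneg: "0 \<le> t\<^sup>2 * ?a + 2 * t * s * ?b + s\<^sup>2 * ?c" for t s
  proof -
    have "0 \<le> (LINT x|M. (norm (t *\<^sub>R f x + s *\<^sub>R g x))\<^sup>2)" by simp
    also have "\<dots> = (LINT x|M. t\<^sup>2 * (norm (f x))\<^sup>2 + 2 * t * s * (f x \<bullet> g x) + s\<^sup>2 * (norm (g x))\<^sup>2)"
    proof (rule Bochner_Integration.integral_cong[OF refl])
      fix x
      show "(norm (t *\<^sub>R f x + s *\<^sub>R g x))\<^sup>2
          = t\<^sup>2 * (norm (f x))\<^sup>2 + 2 * t * s * (f x \<bullet> g x) + s\<^sup>2 * (norm (g x))\<^sup>2"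
        by (simp only: power2_norm_eq_inner inner_add_left inner_add_right inner_scaleR_left
            inner_scaleR_right inner_commute[of "g x" "f x"] power2_eq_square[of t] power2_eq_square[of s])
          (simp only: algebra_simps mult_2)
    qed
    also have "\<dots> = t\<^sup>2 * ?a + 2 * t * s * ?b + s\<^sup>2 * ?c" using int by simp
    finally show ?thesis .
  qed
  have a: "0 \<le> ?a" and c: "0 \<le> ?c" by auto
  have "?b\<^sup>2 \<le> ?a * ?c"
  proof (cases "?a = 0")
    case True
    \<comment> \<open>If \<open>?a = 0\<close>, the form is affine in \<open>t\<close> and can only be nonnegative if it is constant.\<close>
    have "?b = 0"
    proof (rule ccontr)
      assume "?b \<noteq> 0"
      then show False using nonneg[of "- (?c + 1) / (2 * ?b)" 1] True by (simp add: field_simps)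
    qed
    then show ?thesis using a c by simp
  next
    case False
    then have "0 < ?a" using a by linarith
    have "0 \<le> ?a * (?a * ?c - ?b\<^sup>2)"
      using nonneg[of "- ?b" ?a] by (simp add: power2_eq_square algebra_simps)
    then show ?thesis using \<open>0 < ?a\<close> by (simp add: zero_le_mult_iff)
  qed
  then have "sqrt (?b\<^sup>2) \<le> sqrt (?a * ?c)" by (rule real_sqrt_le_mono)
  then show ?thesis by (simp add: L2norm_def real_sqrt_mult)
qed

lemma L2_tendsto_inner:
  assumes f: "\<And>n. f n \<in> L2 M" "f0 \<in> L2 M" and g: "g \<in> L2 M"
    and lim: "(\<lambda>n. L2norm M (\<lambda>x. f n x - f0 x)) \<longlonglongrightarrow> 0"
  shows "(\<lambda>n. LINT x|M. f n x \<bullet> g x) \<longlonglongrightarrow> (LINT x|M. f0 x \<bullet> g x)"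
proof (rule LIM_zero_cancel, rule Lim_null_comparison)
  show "\<forall>\<^sub>F n in sequentially. norm ((LINT x|M. f n x \<bullet> g x) - (LINT x|M. f0 x \<bullet> g x))
      \<le> L2norm M (\<lambda>x. f n x - f0 x) * L2norm M g"
  proof (rule always_eventually, rule allI)
    fix n
    have "(LINT x|M. f n x \<bullet> g x) - (LINT x|M. f0 x \<bullet> g x) = (LINT x|M. (f n x - f0 x) \<bullet> g x)"
      using f g by (simp add: inner_diff_left L2_inner_integrable)
    then show "norm ((LINT x|M. f n x \<bullet> g x) - (LINT x|M. f0 x \<bullet> g x))
      \<le> L2norm M (\<lambda>x. f n x - f0 x) * L2norm M g"
      using L2_inner_le[OF L2_diff[OF f(1) f(2)] g] by simp
  qed
  show "(\<lambda>n. L2norm M (\<lambda>x. f n x - f0 x) * L2norm M g) \<longlonglongrightarrow> 0"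
    using tendsto_mult[OF lim tendsto_const] by simp
qed

lemma L2_tendsto_mult:
  fixes g :: "'a \<Rightarrow> real"
  assumes "\<And>n. f n \<in> L2 M" "f0 \<in> L2 M" "g \<in> L2 M"
    and "(\<lambda>n. L2norm M (\<lambda>x. f n x - f0 x)) \<longlonglongrightarrow> 0"
  shows "(\<lambda>n. LINT x|M. f n x * g x) \<longlonglongrightarrow> (LINT x|M. f0 x * g x)"
  using L2_tendsto_inner[OF assms] by simp

lemma L2norm_mono:
  assumes "AE x in M. norm (f x) \<le> norm (g x)" "f \<in> borel_measurable M" "g \<in> L2 M"
  shows "L2norm M f \<le> L2norm M g"
  unfolding L2norm_def
proof (intro real_sqrt_le_mono integral_mono_AE)
  show sq: "AE x in M. (norm (f x))\<^sup>2 \<le> (norm (g x))\<^sup>2"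
    using assms(1) by eventually_elim (simp add: power_mono)
  show "integrable M (\<lambda>x. (norm (g x))\<^sup>2)" by (rule L2_D[OF assms(3)])
  then show "integrable M (\<lambda>x. (norm (f x))\<^sup>2)"
    using L2_dominated[OF assms(2) _ sq] by (simp add: L2_D)
qed

lemma L2norm_tendsto_0_mono:
  assumes lim: "(\<lambda>n. L2norm M (g n)) \<longlonglongrightarrow> 0"
    and "\<And>n. AE x in M. norm (f n x) \<le> norm (g n x)"
    and "\<And>n. f n \<in> borel_measurable M" "\<And>n. g n \<in> L2 M"
  shows "(\<lambda>n. L2norm M (f n)) \<longlonglongrightarrow> 0"
proof (rule Lim_null_comparison[OF always_eventually lim], rule allI)
  show "norm (L2norm M (f n)) \<le> L2norm M (g n)" for n
    using L2norm_mono[OF assms(2-4)] by (simp add: L2norm_nonneg)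
qed

lemma L2norm_tendsto_0I:
  assumes "(\<lambda>n. LINT x|M. (norm (f n x))\<^sup>2) \<longlonglongrightarrow> 0"
  shows "(\<lambda>n. L2norm M (f n)) \<longlonglongrightarrow> 0"
  using tendsto_real_sqrt[OF assms] by (simp add: L2norm_def)

lemma L2norm_tendsto_0D:
  assumes "(\<lambda>n. L2norm M (f n)) \<longlonglongrightarrow> 0"
  shows "(\<lambda>n. LINT x|M. (norm (f n x))\<^sup>2) \<longlonglongrightarrow> 0"
  using tendsto_power[OF assms, of 2] by (simp add: L2norm_sq)

lemma L2norm_dominated_convergence:
  fixes f :: "nat \<Rightarrow> 'a \<Rightarrow> 'b::euclidean_space"
  assumes "\<And>n. f n \<in> borel_measurable M" "integrable M g"
    and "AE x in M. (\<lambda>n. f n x) \<longlonglongrightarrow> 0" "\<And>n. AE x in M. (norm (f n x))\<^sup>2 \<le> g x"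
  shows "(\<lambda>n. L2norm M (f n)) \<longlonglongrightarrow> 0"
proof (rule L2norm_tendsto_0I)
  have "(\<lambda>n. LINT x|M. (norm (f n x))\<^sup>2) \<longlonglongrightarrow> (LINT x|M. 0)"
  proof (rule integral_dominated_convergence)
    show "AE x in M. (\<lambda>n. (norm (f n x))\<^sup>2) \<longlonglongrightarrow> 0"
      using assms(3)
    proof eventually_elim
      case (elim x)
      show ?case using tendsto_power[OF tendsto_norm[OF elim], of 2] by simp
    qed
    show "AE x in M. norm ((norm (f n x))\<^sup>2) \<le> g x" for n using assms(4)[of n] by simp
  qed (use assms(1,2) in auto)
  then show "(\<lambda>n. LINT x|M. (norm (f n x))\<^sup>2) \<longlonglongrightarrow> 0" by simp
qed

lemma L2norm_tendsto_0_add: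
  assumes "(\<lambda>n. L2norm M (f n)) \<longlonglongrightarrow> 0" "(\<lambda>n. L2norm M (g n)) \<longlonglongrightarrow> 0"
    and "\<And>n. f n \<in> L2 M" "\<And>n. g n \<in> L2 M"
  shows "(\<lambda>n. L2norm M (\<lambda>x. f n x + g n x)) \<longlonglongrightarrow> 0"
proof (rule L2norm_tendsto_0I, rule Lim_null_comparison)
  let ?h = "\<lambda>n. 2 * (LINT x|M. (norm (f n x))\<^sup>2) + 2 * (LINT x|M. (norm (g n x))\<^sup>2)"
  show "?h \<longlonglongrightarrow> 0"
    using tendsto_add[OF tendsto_mult[OF tendsto_const[of 2] L2norm_tendsto_0D[OF assms(1)]]
        tendsto_mult[OF tendsto_const[of 2] L2norm_tendsto_0D[OF assms(2)]]] by simp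
  show "\<forall>\<^sub>F n in sequentially. norm (LINT x|M. (norm (f n x + g n x))\<^sup>2) \<le> ?h n"
  proof (rule always_eventually, rule allI)
    fix n
    note int = L2_D(2)[OF assms(3)[of n]] L2_D(2)[OF assms(4)[of n]]
    have "(LINT x|M. (norm (f n x + g n x))\<^sup>2)
        \<le> (LINT x|M. 2 * (norm (f n x))\<^sup>2 + 2 * (norm (g n x))\<^sup>2)"
      by (rule integral_mono)
        (use int L2_D(2)[OF L2_add[OF assms(3,4)], of n n] norm_add_sq_le in auto)
    also have "\<dots> = ?h n" using int by simp
    finally show "norm (LINT x|M. (norm (f n x + g n x))\<^sup>2) \<le> ?h n" by simp
  qed
qed

section \<open>Test functions\<close>

lemma Ck_SucD: "Ck (Suc k) \<phi> \<Longrightarrow> Ck k \<phi>"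
proof (induction k arbitrary: \<phi>)
  case 0
  then show ?case
    by (auto simp: gderiv_def continuous_on_eq_continuous_at intro: has_derivative_continuous)
next
  case (Suc k)
  from Suc.prems obtain g where "\<forall>x. GDERIV \<phi> x :> g x" "\<forall>i. Ck (Suc k) (\<lambda>x. g x $ i)"
    by (subst (asm) Ck.simps) blast
  then show ?case using Suc.IH by auto
qed

lemma Ck_const: "Ck k (\<lambda>x. c)"
proof (induction k arbitrary: c)
  case (Suc k)
  show ?case using GDERIV_const Suc[of 0] by (auto intro!: exI[of _ "\<lambda>x. 0"])
qed auto

lemma Ck_add: "Ck k \<phi> \<Longrightarrow> Ck k \<psi> \<Longrightarrow> Ck k (\<lambda>x. \<phi> x + \<psi> x)"
proof (induction k arbitrary: \<phi> \<psi>)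
  case 0
  then show ?case by (auto intro: continuous_on_add)
next
  case (Suc k)
  from Suc.prems obtain g h where "\<forall>x. GDERIV \<phi> x :> g x" "\<forall>i. Ck k (\<lambda>x. g x $ i)"
    "\<forall>x. GDERIV \<psi> x :> h x" "\<forall>i. Ck k (\<lambda>x. h x $ i)" by auto
  then show ?case using Suc.IH
    by (auto intro!: exI[of _ "\<lambda>x. g x + h x"] GDERIV_add)
qed

lemma Ck_mult: "Ck k \<phi> \<Longrightarrow> Ck k \<psi> \<Longrightarrow> Ck k (\<lambda>x. \<phi> x * \<psi> x)"
proof (induction k arbitrary: \<phi> \<psi>)
  case 0
  then show ?case by (auto intro: continuous_on_mult)
next
  case (Suc k)
  from Suc.prems obtain g h where gh: "\<forall>x. GDERIV \<phi> x :> g x" "\<forall>i. Ck k (\<lambda>x. g x $ i)"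
    "\<forall>x. GDERIV \<psi> x :> h x" "\<forall>i. Ck k (\<lambda>x. h x $ i)" by auto
  have "Ck k \<phi>" "Ck k \<psi>" using Suc.prems Ck_SucD by blast+
  then have "Ck k (\<lambda>x. (\<phi> x *\<^sub>R h x + \<psi> x *\<^sub>R g x) $ i)" for i
    using gh by (auto intro!: Ck_add Suc.IH)
  moreover have "\<forall>x. GDERIV (\<lambda>x. \<phi> x * \<psi> x) x :> \<phi> x *\<^sub>R h x + \<psi> x *\<^sub>R g x"
    using gh by (auto intro!: GDERIV_mult)
  ultimately show ?case by auto
qed

lemma GDERIV_nth: "GDERIV (\<lambda>x::real^'d::finite. x $ i) x :> axis i 1"
  unfolding gderiv_def inner_axis
  by (auto intro!: derivative_eq_intros bounded_linear.has_derivative[OF bounded_linear_vec_nth])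

lemma Ck_nth: "Ck k (\<lambda>x. x $ i)"
proof (cases k)
  case 0
  then show ?thesis by (simp add: continuous_on_component)
next
  case (Suc n)
  then show ?thesis
    using Ck_const[of n] by (auto intro!: exI[of _ "\<lambda>x. axis i 1"] GDERIV_nth)
qed

lemma GDERIV_unique: "GDERIV \<phi> x :> (g::real^'d::finite) \<Longrightarrow> GDERIV \<phi> x :> h \<Longrightarrow> g = h"
proof -
  assume "GDERIV \<phi> x :> g" "GDERIV \<phi> x :> h"
  then have "(\<lambda>v. v \<bullet> g) = (\<lambda>v. v \<bullet> h)"
    unfolding gderiv_def by (rule has_derivative_unique)
  then have "v \<bullet> g = v \<bullet> h" for v by (rule fun_cong)
  then show "g = h" using vector_eq_ldot[of g h] by blast
qed

lemma grad_eq: "GDERIV \<phi> x :> g \<Longrightarrow> grad \<phi> x = g"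
  unfolding grad_def by (rule the_equality) (auto intro: GDERIV_unique)

definition smooth :: "(real ^ 'd::finite \<Rightarrow> real) \<Rightarrow> bool" where
  "smooth \<phi> \<longleftrightarrow> (\<forall>k. Ck k \<phi>)"

lemma smooth_GDERIV: "smooth \<phi> \<Longrightarrow> GDERIV \<phi> x :> grad \<phi> x"
proof -
  assume "smooth \<phi>"
  then have "Ck (Suc 0) \<phi>" unfolding smooth_def by (rule spec)
  then obtain g where "GDERIV \<phi> x :> g x" unfolding Ck.simps by blast
  then show ?thesis using grad_eq[of \<phi> x "g x"] by simp
qed

lemma smooth_grad_nth: "smooth \<phi> \<Longrightarrow> smooth (\<lambda>x. grad \<phi> x $ i)"
  unfolding smooth_def
proof
  fix k
  assume "\<forall>k. Ck k \<phi>"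
  then have "Ck (Suc k) \<phi>" by (rule spec)
  then obtain g where g: "\<forall>x. GDERIV \<phi> x :> g x" "\<forall>i. Ck k (\<lambda>x. g x $ i)"
    unfolding Ck.simps by blast
  then have "grad \<phi> = g" by (auto simp: fun_eq_iff grad_eq)
  then show "Ck k (\<lambda>x. grad \<phi> x $ i)" using g by simp
qed

lemma smooth_continuous: "smooth \<phi> \<Longrightarrow> continuous_on UNIV \<phi>"
  unfolding smooth_def by (drule spec[of _ 0]) simp

lemma smooth_grad_continuous: "smooth \<phi> \<Longrightarrow> continuous_on UNIV (grad \<phi>)"
  using smooth_continuous[OF smooth_grad_nth, of \<phi>]
  using continuous_on_vec_lambda[of UNIV "\<lambda>i x. grad \<phi> x $ i"] by simp

lemma smooth_mult: "smooth \<phi> \<Longrightarrow> smooth \<psi> \<Longrightarrow> smooth (\<lambda>x. \<phi> x * \<psi> x)"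
  by (simp add: smooth_def Ck_mult)

lemma test_functions_smooth: "\<phi> \<in> test_functions \<Omega> \<Longrightarrow> smooth \<phi>"
  by (simp add: test_functions_def smooth_def)

lemma test_functionsI:
  assumes "smooth \<psi>" "\<phi> \<in> test_functions \<Omega>" "\<And>x. \<phi> x = 0 \<Longrightarrow> \<psi> x = 0"
  shows "\<psi> \<in> test_functions \<Omega>"
proof -
  have "closure {x. \<psi> x \<noteq> 0} \<subseteq> closure {x. \<phi> x \<noteq> 0}"
    using assms(3) by (intro closure_mono) auto
  then show ?thesis
    using assms(1,2) unfolding test_functions_def smooth_def
    by (auto simp: compact_eq_bounded_closed intro: bounded_subset)
qed

lemma test_functions_mult_smooth:
  "smooth \<psi> \<Longrightarrow> \<phi> \<in> test_functions \<Omega> \<Longrightarrow> (\<lambda>x. \<psi> x * \<phi> x) \<in> test_functions \<Omega>"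
  by (rule test_functionsI[of _ \<phi>]) (auto intro: smooth_mult test_functions_smooth)

lemma grad_mult:
  assumes "smooth \<phi>" "smooth \<psi>"
  shows "grad (\<lambda>x. \<phi> x * \<psi> x) x = \<phi> x *\<^sub>R grad \<psi> x + \<psi> x *\<^sub>R grad \<phi> x"
  by (intro grad_eq GDERIV_mult smooth_GDERIV assms)

text \<open>The complement of the closed support is open, so \<open>\<phi>\<close> vanishes near each of its points.\<close>

lemma GDERIV_zero_outside:
  fixes \<phi> :: "real^'d::finite \<Rightarrow> real"
  assumes "x \<notin> closure {x. \<phi> x \<noteq> 0}"
  shows "\<phi> x = 0" "grad \<phi> x = 0"
proof -
  show "\<phi> x = 0" using assms closure_subset by force
  have "GDERIV \<phi> x :> 0"
    unfolding gderiv_def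
  proof (rule has_derivative_transform_within_open)
    show "((\<lambda>x. 0) has_derivative (\<lambda>h. h \<bullet> 0)) (at x)" by simp
    show "open (- closure {x. \<phi> x \<noteq> 0})" by (rule open_Compl) simp
    show "x \<in> - closure {x. \<phi> x \<noteq> 0}" using assms by simp
    show "0 = \<phi> y" if "y \<in> - closure {x. \<phi> x \<noteq> 0}" for y
      using that closure_subset[of "{x. \<phi> x \<noteq> 0}"] by auto
  qed
  then show "grad \<phi> x = 0" by (rule grad_eq)
qed

lemma bounded_compact_support:
  fixes f :: "real^'d::finite \<Rightarrow> 'b::real_normed_vector"
  assumes "continuous_on UNIV f" "compact K" "\<And>x. x \<notin> K \<Longrightarrow> f x = 0"
  obtains C where "0 \<le> C" "\<And>x. norm (f x) \<le> C"
proof -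
  have "compact (f ` K)"
    by (rule compact_continuous_image[OF continuous_on_subset[OF assms(1)] assms(2)]) simp
  then obtain C where C: "\<forall>z\<in>f ` K. norm z \<le> C"
    using compact_imp_bounded bounded_iff by blast
  have "norm (f x) \<le> max 0 C" for x using C assms(3)[of x] by (cases "x \<in> K") auto
  then show ?thesis using that[of "max 0 C"] by simp
qed

text \<open>The integral of \<open>\<psi>\<close> is invariant under translation, so the difference
  quotients of \<open>\<psi>\<close> in a coordinate direction have integral zero. They converge to the
  partial derivative, and they are bounded by a constant on a fixed ball because \<open>\<psi>\<close> is Lipschitz
  continuous with compact support.\<close>

lemma integral_grad_eq_0:
  fixes \<psi> :: "real^'d::finite \<Rightarrow> real"
  assumes sm: "smooth \<psi>" and K: "compact (closure {x. \<psi> x \<noteq> 0})"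
  shows "(LINT x|lborel. grad \<psi> x $ i) = 0"
proof -
  let ?K = "closure {x. \<psi> x \<noteq> 0}" and ?e = "axis i 1 :: real^'d"
  define h where "h n = 1 / real (Suc n)" for n
  have h: "0 < h n" "h n \<le> 1" for n by (auto simp: h_def)
  define s where "s n x = (\<psi> (h n *\<^sub>R ?e + x) - \<psi> x) / h n" for n x
  obtain C where C: "0 \<le> C" "\<And>x. norm (grad \<psi> x) \<le> C"
    by (rule bounded_compact_support[OF smooth_grad_continuous[OF sm] K GDERIV_zero_outside(2)[of _ \<psi>]]) auto
  obtain B where B: "\<And>x. norm (\<psi> x) \<le> B"
    by (rule bounded_compact_support[OF smooth_continuous[OF sm] K GDERIV_zero_outside(1)[of _ \<psi>]]) auto
  obtain R where R: "?K \<subseteq> cball 0 R"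
    using compact_imp_bounded[OF K] unfolding bounded_iff by (auto simp: subset_iff)
  have [measurable]: "\<psi> \<in> borel_measurable borel" "grad \<psi> \<in> borel_measurable borel"
    "(\<lambda>x. grad \<psi> x $ i) \<in> borel_measurable borel"
    using smooth_continuous[OF sm] smooth_grad_continuous[OF sm]
      smooth_continuous[OF smooth_grad_nth[OF sm]]
    by (auto intro: borel_measurable_continuous_onI)
  have zero: "\<psi> x = 0" if "x \<notin> cball 0 R" for x
    using GDERIV_zero_outside(1)[of x \<psi>] R that by blast
  have ball: "integrable lborel (\<lambda>x. D * indicator (cball 0 S) x :: real)" for D S
    by (auto intro!: integrable_real_indicator emeasure_bounded_finite[unfolded infinity_ennreal_def])
  have int: "integrable lborel \<psi>"
    by (rule Bochner_Integration.integrable_bound[OF ball[of B R]])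
      (use B zero in \<open>auto split: split_indicator intro!: AE_I2 order_trans[OF _ abs_ge_self] simp del: mem_cball\<close>)
  have trans: "integrable lborel (\<lambda>x. \<psi> (a + x))" "(LINT x|lborel. \<psi> (a + x)) = (LINT x|lborel. \<psi> x)" for a
    using int integrable_distr_eq[of "(+) a" lborel borel \<psi>] integral_distr[of "(+) a" lborel borel \<psi>]
    by (simp_all add: lborel_distr_plus)
  have int_s: "(LINT x|lborel. s n x) = 0" for n
    unfolding s_def using trans[of "h n *\<^sub>R ?e"] int by simp
  have lip: "norm (\<psi> x - \<psi> y) \<le> C * norm (x - y)" for x y
  proof (rule differentiable_bound[of UNIV \<psi> "\<lambda>x h. h \<bullet> grad \<psi> x"])
    show "(\<psi> has_derivative (\<lambda>h. h \<bullet> grad \<psi> x)) (at x within UNIV)" for x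
      using smooth_GDERIV[OF sm, of x] by (simp add: gderiv_def)
    show "onorm (\<lambda>h. h \<bullet> grad \<psi> x) \<le> C" for x
    proof (rule onorm_le)
      fix v
      have "norm (v \<bullet> grad \<psi> x) \<le> norm v * norm (grad \<psi> x)" by (simp add: Cauchy_Schwarz_ineq2)
      also have "\<dots> \<le> norm v * C" using C(2) by (intro mult_left_mono) auto
      finally show "norm (v \<bullet> grad \<psi> x) \<le> C * norm v" by (simp add: mult.commute)
    qed
  qed auto
  have bound: "norm (s n x) \<le> C * indicator (cball 0 (R + 1)) x" for n x
  proof (cases "x \<in> cball 0 (R + 1)")
    case True
    have "norm (\<psi> (h n *\<^sub>R ?e + x) - \<psi> x) \<le> C * h n"
      using lip[of "h n *\<^sub>R ?e + x" x] h[of n] by simp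
    then show ?thesis using True h[of n] by (simp add: s_def field_simps)
  next
    case False
    have "norm x \<le> norm (h n *\<^sub>R ?e + x) + norm (h n *\<^sub>R ?e)"
      using norm_triangle_ineq4[of "h n *\<^sub>R ?e + x" "h n *\<^sub>R ?e"] by simp
    also have "norm (h n *\<^sub>R ?e) \<le> 1" using h[of n] by simp
    finally have "\<psi> (h n *\<^sub>R ?e + x) = 0" "\<psi> x = 0" using False by (auto intro!: zero)
    then show ?thesis using False by (simp add: s_def)
  qed
  have lim: "(\<lambda>n. s n x) \<longlonglongrightarrow> grad \<psi> x $ i" for x
  proof -
    have 0: "((\<lambda>t. t *\<^sub>R ?e + x) has_derivative (\<lambda>t. t *\<^sub>R ?e)) (at 0)"
      by (auto intro!: derivative_eq_intros)
    have 1: "(\<psi> has_derivative (\<lambda>h. h \<bullet> grad \<psi> x)) (at (0 *\<^sub>R ?e + x))"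
      using smooth_GDERIV[OF sm, of x] by (simp add: gderiv_def)
    have "((\<lambda>t. \<psi> (t *\<^sub>R ?e + x)) has_derivative (\<lambda>t. (t *\<^sub>R ?e) \<bullet> grad \<psi> x)) (at 0)"
      using has_derivative_compose[OF 0 1] .
    moreover have "(\<lambda>t. (t *\<^sub>R ?e) \<bullet> grad \<psi> x) = (*) (grad \<psi> x $ i)"
      by (auto simp: fun_eq_iff inner_axis')
    ultimately have "((\<lambda>t. \<psi> (t *\<^sub>R ?e + x)) has_real_derivative (grad \<psi> x $ i)) (at 0)"
      by (simp add: has_field_derivative_def)
    then have "((\<lambda>t. (\<psi> (t *\<^sub>R ?e + x) - \<psi> x) / t) \<longlongrightarrow> grad \<psi> x $ i) (at 0)"
      by (simp add: has_field_derivative_iff)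
    moreover have "filterlim h (at 0) sequentially"
      unfolding h_def filterlim_at
      using LIMSEQ_inverse_real_of_nat by (auto simp: inverse_eq_divide simp del: of_nat_Suc)
    ultimately show ?thesis unfolding s_def by (rule filterlim_compose)
  qed
  have "(\<lambda>n. LINT x|lborel. s n x) \<longlonglongrightarrow> (LINT x|lborel. grad \<psi> x $ i)"
  proof (rule integral_dominated_convergence)
    show "integrable lborel (\<lambda>x. C * indicator (cball 0 (R + 1)) x)" by (rule ball)
    show "s n \<in> borel_measurable lborel" for n unfolding s_def[abs_def] by measurable
  qed (use bound lim in auto)
  then have "(\<lambda>n. 0) \<longlonglongrightarrow> (LINT x|lborel. grad \<psi> x $ i)" by (simp only: int_s)
  then show ?thesis using LIMSEQ_unique[OF tendsto_const[of 0]] by simp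
qed

section \<open>Sobolev functions with zero boundary values\<close>

lemma bounded_domain_lmeasurable: "bounded_domain \<Omega> \<Longrightarrow> \<Omega> \<in> lmeasurable"
  by (simp add: bounded_domain_def lmeasurable_open)

lemma continuous_measurable_lebesgue_on:
  "continuous_on UNIV f \<Longrightarrow> f \<in> borel_measurable (lebesgue_on \<Omega>)"
  by (intro measurable_restrict_space1 measurable_completion)
    (simp add: borel_measurable_continuous_onI)

lemma bounded_L2:
  assumes "\<Omega> \<in> lmeasurable" "f \<in> borel_measurable (lebesgue_on \<Omega>)" "\<And>x. x \<in> \<Omega> \<Longrightarrow> norm (f x) \<le> C"
  shows "f \<in> L2 (lebesgue_on \<Omega>)"
proof (rule L2_dominated[OF assms(2)])
  interpret finite_measure "lebesgue_on \<Omega>" using assms(1) by (rule finite_measure_lebesgue_on)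
  show "integrable (lebesgue_on \<Omega>) (\<lambda>x. C\<^sup>2)" by simp
  show "AE x in lebesgue_on \<Omega>. (norm (f x))\<^sup>2 \<le> C\<^sup>2"
    using assms(3) by (intro AE_I2 power_mono) auto
qed

lemma test_functions_compact: "\<phi> \<in> test_functions \<Omega> \<Longrightarrow> compact (closure {x. \<phi> x \<noteq> 0})"
  by (simp add: test_functions_def)

lemma test_functions_bounded:
  assumes "\<phi> \<in> test_functions \<Omega>"
  obtains C where "\<And>x. \<bar>\<phi> x\<bar> \<le> C"
  using bounded_compact_support[OF smooth_continuous[OF test_functions_smooth[OF assms]]
    test_functions_compact[OF assms] GDERIV_zero_outside(1)[of _ \<phi>]] by auto

lemma test_functions_L2:
  assumes "\<Omega> \<in> lmeasurable" and \<phi>: "\<phi> \<in> test_functions \<Omega>"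
  shows "\<phi> \<in> L2 (lebesgue_on \<Omega>)" "grad \<phi> \<in> L2 (lebesgue_on \<Omega>)"
proof -
  have c: "continuous_on UNIV \<phi>" "continuous_on UNIV (grad \<phi>)"
    using smooth_continuous smooth_grad_continuous test_functions_smooth[OF \<phi>] by blast+
  obtain C where "\<And>x. norm (\<phi> x) \<le> C" using test_functions_bounded[OF \<phi>] by auto
  then show "\<phi> \<in> L2 (lebesgue_on \<Omega>)"
    using bounded_L2[OF assms(1) continuous_measurable_lebesgue_on[OF c(1)]] by blast
  obtain C where "\<And>x. norm (grad \<phi> x) \<le> C"
    using bounded_compact_support[OF c(2) test_functions_compact[OF \<phi>] GDERIV_zero_outside(2)[of _ \<phi>]]
    by auto
  then show "grad \<phi> \<in> L2 (lebesgue_on \<Omega>)"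
    using bounded_L2[OF assms(1) continuous_measurable_lebesgue_on[OF c(2)]] by blast
qed

lemma test_functions_integral_grad:
  assumes "\<Omega> \<in> lmeasurable" "\<eta> \<in> test_functions \<Omega>"
  shows "(LINT x|lebesgue_on \<Omega>. grad \<eta> x $ i) = 0"
proof -
  have "(LINT x|lebesgue_on \<Omega>. grad \<eta> x $ i) = (LINT x|lebesgue. indicator \<Omega> x *\<^sub>R (grad \<eta> x $ i))"
    using assms(1) by (intro integral_restrict_space) (auto intro: fmeasurableD)
  also have "\<dots> = (LINT x|lebesgue. grad \<eta> x $ i)"
  proof (rule Bochner_Integration.integral_cong[OF refl])
    fix x
    have "grad \<eta> x = 0" if "x \<notin> \<Omega>"
      using that assms(2) by (intro GDERIV_zero_outside(2)) (auto simp: test_functions_def)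
    then show "indicator \<Omega> x *\<^sub>R (grad \<eta> x $ i) = grad \<eta> x $ i" by (cases "x \<in> \<Omega>") auto
  qed
  also have "\<dots> = (LINT x|lborel. grad \<eta> x $ i)"
    using smooth_continuous[OF smooth_grad_nth[OF test_functions_smooth[OF assms(2)]]]
    by (intro integral_completion) (simp add: borel_measurable_continuous_onI)
  also have "\<dots> = 0"
    using integral_grad_eq_0[OF test_functions_smooth[OF assms(2)] test_functions_compact[OF assms(2)]] .
  finally show ?thesis .
qed

lemma test_functions_integrate_by_parts:
  assumes "\<Omega> \<in> lmeasurable" and \<phi>: "\<phi> \<in> test_functions \<Omega>" and \<psi>: "\<psi> \<in> test_functions \<Omega>"
  shows "(LINT x|lebesgue_on \<Omega>. \<phi> x * grad \<psi> x $ i) = - (LINT x|lebesgue_on \<Omega>. \<psi> x * grad \<phi> x $ i)"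
proof -
  let ?M = "lebesgue_on \<Omega>"
  have sm: "smooth \<phi>" "smooth \<psi>" using \<phi> \<psi> test_functions_smooth by auto
  note L2 = test_functions_L2[OF assms(1) \<phi>] test_functions_L2[OF assms(1) \<psi>]
  have "0 = (LINT x|?M. grad (\<lambda>x. \<phi> x * \<psi> x) x $ i)"
    using test_functions_integral_grad[OF assms(1) test_functions_mult_smooth[OF sm(1) \<psi>]] by simp
  also have "\<dots> = (LINT x|?M. \<phi> x * grad \<psi> x $ i + \<psi> x * grad \<phi> x $ i)"
    by (simp add: grad_mult[OF sm])
  also have "\<dots> = (LINT x|?M. \<phi> x * grad \<psi> x $ i) + (LINT x|?M. \<psi> x * grad \<phi> x $ i)"
    using L2 by (intro Bochner_Integration.integral_add L2_mult_integrable L2_nth)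
  finally show ?thesis by simp
qed

lemma integrable_scaleR_L2:
  assumes "f \<in> L2 M" "G \<in> L2 M"
  shows "integrable M (\<lambda>x. f x *\<^sub>R G x)"
proof (rule Bochner_Integration.integrable_bound)
  have "(\<lambda>x. norm (f x)) \<in> L2 M" "(\<lambda>x. norm (G x)) \<in> L2 M"
    using assms by (auto simp: L2_def)
  then show "integrable M (\<lambda>x. norm (f x) * norm (G x))" by (rule L2_mult_integrable)
qed (use assms in \<open>auto simp: L2_def\<close>)

text \<open>The components of the vector-valued integrals are scalar pairings in \<open>L\<^sup>2\<close>, to which
  \<open>L2_tendsto_mult\<close> applies.\<close>

lemma has_weak_gradient_componentwise:
  assumes "\<Omega> \<in> lmeasurable"
  shows "has_weak_gradient \<Omega> y G \<longleftrightarrow> y \<in> L2 (lebesgue_on \<Omega>) \<and> G \<in> L2 (lebesgue_on \<Omega>) \<and>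
     (\<forall>\<phi>\<in>test_functions \<Omega>. \<forall>i.
        (LINT x|lebesgue_on \<Omega>. y x * grad \<phi> x $ i) = - (LINT x|lebesgue_on \<Omega>. \<phi> x * G x $ i))"
proof -
  let ?M = "lebesgue_on \<Omega>"
  have nth: "(LINT x|?M. f x *\<^sub>R F x) $ i = (LINT x|?M. f x * F x $ i)"
    if "f \<in> L2 ?M" "F \<in> L2 ?M" for f and F :: "real^'a \<Rightarrow> real^'a" and i
    using integral_bounded_linear[OF bounded_linear_vec_nth integrable_scaleR_L2[OF that], of i] by simp
  have "(LINT x|?M. y x *\<^sub>R grad \<phi> x) = - (LINT x|?M. \<phi> x *\<^sub>R G x) \<longleftrightarrow>
      (\<forall>i. (LINT x|?M. y x * grad \<phi> x $ i) = - (LINT x|?M. \<phi> x * G x $ i))"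
    if "y \<in> L2 ?M" "G \<in> L2 ?M" "\<phi> \<in> test_functions \<Omega>" for \<phi>
    using that test_functions_L2[OF assms that(3)] by (simp add: vec_eq_iff nth)
  then show ?thesis unfolding has_weak_gradient_def by blast
qed

text \<open>The pairs \<open>(y, G)\<close> in the closure of the graph of the gradient on test functions. That \<open>G\<close>
  is then the weak gradient of \<open>y\<close> is \<open>H10_gradient_weak\<close>.\<close>

definition H10_gradient ::
  "(real ^ 'd::finite) set \<Rightarrow> (real ^ 'd \<Rightarrow> real) \<Rightarrow> (real ^ 'd \<Rightarrow> real ^ 'd) \<Rightarrow> bool" where
  "H10_gradient \<Omega> y G \<longleftrightarrow> y \<in> L2 (lebesgue_on \<Omega>) \<and> G \<in> L2 (lebesgue_on \<Omega>) \<and>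
     (\<exists>\<phi>. (\<forall>n::nat. \<phi> n \<in> test_functions \<Omega>) \<and>
        (\<lambda>n. L2norm (lebesgue_on \<Omega>) (\<lambda>x. \<phi> n x - y x)) \<longlonglongrightarrow> 0 \<and>
        (\<lambda>n. L2norm (lebesgue_on \<Omega>) (\<lambda>x. grad (\<phi> n) x - G x)) \<longlonglongrightarrow> 0)"

lemma L2norm_nth_tendsto_0:
  fixes F :: "nat \<Rightarrow> 'a \<Rightarrow> real^'d::finite"
  assumes "(\<lambda>n. L2norm M (\<lambda>x. F n x - G x)) \<longlonglongrightarrow> 0" "\<And>n. F n \<in> L2 M" "G \<in> L2 M"
  shows "(\<lambda>n. L2norm M (\<lambda>x. F n x $ i - G x $ i)) \<longlonglongrightarrow> 0"
proof (rule L2norm_tendsto_0_mono[OF assms(1)])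
  show "AE x in M. norm (F n x $ i - G x $ i) \<le> norm (F n x - G x)" for n
    using component_le_norm_cart[of "F n x - G x" i for x] by (intro AE_I2) simp
  show "(\<lambda>x. F n x $ i - G x $ i) \<in> borel_measurable M" for n
    using assms by (intro L2_D(1) L2_diff L2_nth)
  show "(\<lambda>x. F n x - G x) \<in> L2 M" for n
    using assms by (intro L2_diff)
qed

text \<open>Integration by parts holds for two test functions and is stable under \<open>L\<^sup>2\<close>-limits in one of
  them.\<close>

lemma H10_gradient_weak:
  assumes \<Omega>: "\<Omega> \<in> lmeasurable" and G: "H10_gradient \<Omega> y G"
  shows "has_weak_gradient \<Omega> y G"
  unfolding has_weak_gradient_componentwise[OF \<Omega>]
proof (intro conjI ballI allI)
  let ?M = "lebesgue_on \<Omega>"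
  show y: "y \<in> L2 ?M" and G2: "G \<in> L2 ?M" using G by (auto simp: H10_gradient_def)
  obtain \<phi> where \<phi>: "\<And>n. \<phi> n \<in> test_functions \<Omega>"
    and lim: "(\<lambda>n. L2norm ?M (\<lambda>x. \<phi> n x - y x)) \<longlonglongrightarrow> 0"
      "(\<lambda>n. L2norm ?M (\<lambda>x. grad (\<phi> n) x - G x)) \<longlonglongrightarrow> 0"
    using G unfolding H10_gradient_def by blast
  fix \<psi> i
  assume \<psi>: "\<psi> \<in> test_functions \<Omega>"
  note L2 = test_functions_L2[OF \<Omega> \<phi>] test_functions_L2[OF \<Omega> \<psi>]
  have 1: "(\<lambda>n. LINT x|?M. \<phi> n x * grad \<psi> x $ i) \<longlonglongrightarrow> (LINT x|?M. y x * grad \<psi> x $ i)"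
    by (intro L2_tendsto_mult L2_nth L2 y lim)
  have "(\<lambda>n. LINT x|?M. grad (\<phi> n) x $ i * \<psi> x) \<longlonglongrightarrow> (LINT x|?M. G x $ i * \<psi> x)"
    by (intro L2_tendsto_mult L2norm_nth_tendsto_0 L2_nth L2 G2 lim)
  then have 2: "(\<lambda>n. LINT x|?M. \<psi> x * grad (\<phi> n) x $ i) \<longlonglongrightarrow> (LINT x|?M. \<psi> x * G x $ i)"
    by (simp add: mult.commute)
  have "(\<lambda>n. LINT x|?M. \<phi> n x * grad \<psi> x $ i) \<longlonglongrightarrow> - (LINT x|?M. \<psi> x * G x $ i)"
    using tendsto_minus[OF 2] by (simp add: test_functions_integrate_by_parts[OF \<Omega> \<phi> \<psi>])
  then show "(LINT x|?M. y x * grad \<psi> x $ i) = - (LINT x|?M. \<psi> x * G x $ i)"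
    by (rule LIMSEQ_unique[OF 1])
qed

lemma H10_iff: "\<Omega> \<in> lmeasurable \<Longrightarrow> y \<in> H10 \<Omega> \<longleftrightarrow> (\<exists>G. H10_gradient \<Omega> y G)"
  using H10_gradient_weak unfolding H10_def H10_gradient_def has_weak_gradient_def by blast

lemma H10_gradient_uminus:
  assumes "H10_gradient \<Omega> y G"
  shows "H10_gradient \<Omega> (\<lambda>x. - y x) (\<lambda>x. - G x)"
proof -
  obtain \<phi> where \<phi>: "\<And>n. \<phi> n \<in> test_functions \<Omega>"
    and lim: "(\<lambda>n. L2norm (lebesgue_on \<Omega>) (\<lambda>x. \<phi> n x - y x)) \<longlonglongrightarrow> 0"
      "(\<lambda>n. L2norm (lebesgue_on \<Omega>) (\<lambda>x. grad (\<phi> n) x - G x)) \<longlonglongrightarrow> 0"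
    using assms unfolding H10_gradient_def by blast
  have g: "grad (\<lambda>x. - \<phi> n x) x = - grad (\<phi> n) x" for n x
    by (intro grad_eq GDERIV_minus smooth_GDERIV test_functions_smooth[OF \<phi>])
  have t: "(\<lambda>x. - \<phi> n x) \<in> test_functions \<Omega>" for n
    using test_functions_mult_smooth[OF _ \<phi>, of "\<lambda>x. -1" n] by (simp add: smooth_def Ck_const)
  have n: "L2norm (lebesgue_on \<Omega>) (\<lambda>x. y x - \<phi> n x) = L2norm (lebesgue_on \<Omega>) (\<lambda>x. \<phi> n x - y x)"
    "L2norm (lebesgue_on \<Omega>) (\<lambda>x. G x - grad (\<phi> n) x) = L2norm (lebesgue_on \<Omega>) (\<lambda>x. grad (\<phi> n) x - G x)" for n
    unfolding L2norm_def by (simp_all add: norm_minus_commute power2_commute)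
  have "(\<lambda>n. L2norm (lebesgue_on \<Omega>) (\<lambda>x. - \<phi> n x - - y x)) \<longlonglongrightarrow> 0"
    "(\<lambda>n. L2norm (lebesgue_on \<Omega>) (\<lambda>x. grad (\<lambda>x. - \<phi> n x) x - - G x)) \<longlonglongrightarrow> 0"
    using lim by (simp_all add: n g)
  then show ?thesis
    using assms t unfolding H10_gradient_def by (auto simp: L2_uminus intro!: exI[of _ "\<lambda>n x. - \<phi> n x"])
qed

lemma H10_gradient_add:
  assumes \<Omega>: "\<Omega> \<in> lmeasurable" and y: "H10_gradient \<Omega> y G" and z: "H10_gradient \<Omega> z F"
  shows "H10_gradient \<Omega> (\<lambda>x. y x + z x) (\<lambda>x. G x + F x)"
proof -
  let ?M = "lebesgue_on \<Omega>"
  obtain \<phi> where \<phi>: "\<And>n. \<phi> n \<in> test_functions \<Omega>"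
    and lim: "(\<lambda>n. L2norm ?M (\<lambda>x. \<phi> n x - y x)) \<longlonglongrightarrow> 0"
      "(\<lambda>n. L2norm ?M (\<lambda>x. grad (\<phi> n) x - G x)) \<longlonglongrightarrow> 0"
    using y unfolding H10_gradient_def by blast
  obtain \<psi> where \<psi>: "\<And>n. \<psi> n \<in> test_functions \<Omega>"
    and lim': "(\<lambda>n. L2norm ?M (\<lambda>x. \<psi> n x - z x)) \<longlonglongrightarrow> 0"
      "(\<lambda>n. L2norm ?M (\<lambda>x. grad (\<psi> n) x - F x)) \<longlonglongrightarrow> 0"
    using z unfolding H10_gradient_def by blast
  have L2: "y \<in> L2 ?M" "z \<in> L2 ?M" "G \<in> L2 ?M" "F \<in> L2 ?M"
    using y z by (auto simp: H10_gradient_def)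
  note L2' = test_functions_L2[OF \<Omega> \<phi>] test_functions_L2[OF \<Omega> \<psi>]
  have g: "grad (\<lambda>x. \<phi> n x + \<psi> n x) x = grad (\<phi> n) x + grad (\<psi> n) x" for n x
    by (intro grad_eq GDERIV_add smooth_GDERIV test_functions_smooth[OF \<phi>] test_functions_smooth[OF \<psi>])
  have t: "(\<lambda>x. \<phi> n x + \<psi> n x) \<in> test_functions \<Omega>" for n
  proof -
    have "closure {x. \<phi> n x + \<psi> n x \<noteq> 0} \<subseteq> closure ({x. \<phi> n x \<noteq> 0} \<union> {x. \<psi> n x \<noteq> 0})"
      by (rule closure_mono) auto
    then have "closure {x. \<phi> n x + \<psi> n x \<noteq> 0} \<subseteq> closure {x. \<phi> n x \<noteq> 0} \<union> closure {x. \<psi> n x \<noteq> 0}"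
      by (simp add: closure_Un)
    then show ?thesis
      using \<phi>[of n] \<psi>[of n] unfolding test_functions_def compact_eq_bounded_closed
      by (auto intro!: Ck_add dest: bounded_subset[OF bounded_Un[THEN iffD2, OF conjI]])
  qed
  have "(\<lambda>n. L2norm ?M (\<lambda>x. (\<phi> n x - y x) + (\<psi> n x - z x))) \<longlonglongrightarrow> 0"
    "(\<lambda>n. L2norm ?M (\<lambda>x. (grad (\<phi> n) x - G x) + (grad (\<psi> n) x - F x))) \<longlonglongrightarrow> 0"
    by (intro L2norm_tendsto_0_add lim lim' L2_diff L2 L2')+
  then have "(\<lambda>n. L2norm ?M (\<lambda>x. (\<phi> n x + \<psi> n x) - (y x + z x))) \<longlonglongrightarrow> 0"
    "(\<lambda>n. L2norm ?M (\<lambda>x. grad (\<lambda>x. \<phi> n x + \<psi> n x) x - (G x + F x))) \<longlonglongrightarrow> 0"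
    by (simp_all add: g add_diff_add)
  then show ?thesis
    using L2 t unfolding H10_gradient_def
    by (auto simp: L2_add intro!: exI[of _ "\<lambda>n x. \<phi> n x + \<psi> n x"])
qed

text \<open>The product \<open>x\<^sub>i * \<phi>\<^sub>n\<close> is a test function with \<open>i\<close>-th partial derivative
  \<open>\<phi>\<^sub>n + x\<^sub>i * \<partial>\<^sub>i \<phi>\<^sub>n\<close>. Testing the weak gradient of \<open>y\<close> with it and passing to the limit
  \<open>\<phi>\<^sub>n \<rightarrow> y\<close> gives \<open>\<integral> y\<^sup>2 = - 2 * \<integral> x\<^sub>i * y * G\<^sub>i\<close>, and Young's inequality absorbs \<open>y\<close>.\<close>

lemma poincare_inequality:
  fixes \<Omega> :: "(real ^ 'd::finite) set"
  assumes \<Omega>: "\<Omega> \<in> lmeasurable" and R: "\<And>x. x \<in> \<Omega> \<Longrightarrow> norm x \<le> R" and G: "H10_gradient \<Omega> y G"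
  shows "(LINT x|lebesgue_on \<Omega>. (y x)\<^sup>2) \<le> 4 * R\<^sup>2 * (LINT x|lebesgue_on \<Omega>. (norm (G x))\<^sup>2)"
proof -
  let ?M = "lebesgue_on \<Omega>"
  \<comment> \<open>The coordinate is arbitrary; the estimate holds for each of them.\<close>
  fix i :: 'd
  have y: "y \<in> L2 ?M" and G2: "G \<in> L2 ?M" using G by (auto simp: H10_gradient_def)
  have c: "continuous_on UNIV (\<lambda>x::real^'d. x $ i)" by (simp add: continuous_on_component)
  have sm: "smooth (\<lambda>x::real^'d. x $ i)" by (simp add: smooth_def Ck_nth)
  have le: "AE x in ?M. \<bar>x $ i\<bar> \<le> R"
  proof (rule AE_I2)
    fix x
    assume "x \<in> space ?M"
    then show "\<bar>x $ i\<bar> \<le> R" using R[of x] component_le_norm_cart[of x i] by simp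
  qed
  have xL2: "(\<lambda>x. x $ i * f x) \<in> L2 ?M" if "f \<in> L2 ?M" for f :: "real^'d \<Rightarrow> real"
    using L2_scaleR_bounded[OF that continuous_measurable_lebesgue_on[OF c] le] by simp
  obtain \<phi> where \<phi>: "\<And>n. \<phi> n \<in> test_functions \<Omega>"
    and lim: "(\<lambda>n. L2norm ?M (\<lambda>x. \<phi> n x - y x)) \<longlonglongrightarrow> 0"
      "(\<lambda>n. L2norm ?M (\<lambda>x. grad (\<phi> n) x - G x)) \<longlonglongrightarrow> 0"
    using G unfolding H10_gradient_def by blast
  note L2 = test_functions_L2[OF \<Omega> \<phi>]
  have weak: "(LINT x|?M. \<phi> n x * y x) + (LINT x|?M. grad (\<phi> n) x $ i * (x $ i * y x))
      = - (LINT x|?M. \<phi> n x * (x $ i * G x $ i))" for n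
  proof -
    have "grad (\<lambda>x. x $ i * \<phi> n x) x $ i = \<phi> n x + x $ i * grad (\<phi> n) x $ i" for x
      by (simp add: grad_mult[OF sm test_functions_smooth[OF \<phi>]] grad_eq[OF GDERIV_nth])
    then have "(LINT x|?M. \<phi> n x * y x + grad (\<phi> n) x $ i * (x $ i * y x))
        = (LINT x|?M. y x * grad (\<lambda>x. x $ i * \<phi> n x) x $ i)"
      by (simp add: algebra_simps)
    also have "\<dots> = - (LINT x|?M. (x $ i * \<phi> n x) * G x $ i)"
      using H10_gradient_weak[OF \<Omega> G] test_functions_mult_smooth[OF sm \<phi>]
      unfolding has_weak_gradient_componentwise[OF \<Omega>] by blast
    also have "\<dots> = - (LINT x|?M. \<phi> n x * (x $ i * G x $ i))"
      by (simp add: mult.left_commute mult.assoc)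
    finally show ?thesis
      using Bochner_Integration.integral_add[OF L2_mult_integrable[OF L2(1) y]
          L2_mult_integrable[OF L2_nth[OF L2(2)] xL2[OF y]], of n n i] by simp
  qed
  have 1: "(\<lambda>n. (LINT x|?M. \<phi> n x * y x) + (LINT x|?M. grad (\<phi> n) x $ i * (x $ i * y x)))
      \<longlonglongrightarrow> (LINT x|?M. y x * y x) + (LINT x|?M. G x $ i * (x $ i * y x))"
    by (intro tendsto_add L2_tendsto_mult L2norm_nth_tendsto_0 L2 L2_nth y G2 lim xL2)
  have "(\<lambda>n. - (LINT x|?M. \<phi> n x * (x $ i * G x $ i))) \<longlonglongrightarrow> - (LINT x|?M. y x * (x $ i * G x $ i))"
    by (intro tendsto_minus L2_tendsto_mult L2 L2_nth y G2 lim xL2)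
  then have "(LINT x|?M. y x * y x) + (LINT x|?M. G x $ i * (x $ i * y x))
      = - (LINT x|?M. y x * (x $ i * G x $ i))"
    using LIMSEQ_unique[OF 1] by (simp add: weak)
  then have eq: "(LINT x|?M. (y x)\<^sup>2) = - 2 * (LINT x|?M. y x * (x $ i * G x $ i))"
    by (simp add: power2_eq_square mult.commute mult.left_commute)
  have int: "integrable ?M (\<lambda>x. (y x)\<^sup>2)" "integrable ?M (\<lambda>x. (norm (G x))\<^sup>2)"
    using L2_D(2)[OF y] L2_D(2)[OF G2] by auto
  have "(LINT x|?M. - 2 * (y x * (x $ i * G x $ i)))
      \<le> (LINT x|?M. (y x)\<^sup>2 / 2 + 2 * R\<^sup>2 * (norm (G x))\<^sup>2)"
  proof (rule integral_mono)
    show "integrable ?M (\<lambda>x. - 2 * (y x * (x $ i * G x $ i)))"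
      by (intro Bochner_Integration.integrable_mult_right L2_mult_integrable y xL2 L2_nth G2)
    show "integrable ?M (\<lambda>x. (y x)\<^sup>2 / 2 + 2 * R\<^sup>2 * (norm (G x))\<^sup>2)" using int by auto
    fix x
    assume "x \<in> space ?M"
    then have "norm x \<le> R" using R by simp
    have "\<bar>x $ i * G x $ i\<bar> \<le> R * norm (G x)"
      unfolding abs_mult using component_le_norm_cart[of x i] component_le_norm_cart[of "G x" i] \<open>norm x \<le> R\<close>
      by (intro mult_mono) auto
    then have "(x $ i * G x $ i)\<^sup>2 \<le> R\<^sup>2 * (norm (G x))\<^sup>2"
      using power_mono[of "\<bar>x $ i * G x $ i\<bar>" "R * norm (G x)" 2] by (simp add: power_mult_distrib)
    moreover have "0 \<le> (y x + 2 * (x $ i * G x $ i))\<^sup>2" by simp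
    ultimately show "- 2 * (y x * (x $ i * G x $ i)) \<le> (y x)\<^sup>2 / 2 + 2 * R\<^sup>2 * (norm (G x))\<^sup>2"
      by (simp add: power2_sum power_mult_distrib)
  qed
  also have "(LINT x|?M. - 2 * (y x * (x $ i * G x $ i))) = (LINT x|?M. (y x)\<^sup>2)"
    unfolding eq by (rule integral_mult_right_zero)
  finally show ?thesis using int by simp
qed

text \<open>The chain rule. If \<open>\<phi>\<^sub>n\<close> approximates \<open>y\<close>, then \<open>\<Phi>(\<phi>\<^sub>n)\<close> approximates \<open>\<Phi>(y)\<close> because \<open>\<Phi>\<close> is
  Lipschitz continuous. For the gradients, \<open>\<Phi>'(\<phi>\<^sub>n) * (\<nabla>\<phi>\<^sub>n - G)\<close> is small since \<open>\<Phi>'\<close> is bounded, and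
  \<open>(\<Phi>'(\<phi>\<^sub>n) - \<Phi>'(y)) * G\<close> is small by dominated convergence along a subsequence which
  converges almost everywhere.\<close>

lemma H10_gradient_compose:
  fixes \<Omega> :: "(real ^ 'd::finite) set"
  assumes \<Omega>: "\<Omega> \<in> lmeasurable" and G: "H10_gradient \<Omega> y G"
    and \<Phi>0: "\<Phi> 0 = 0" and deriv: "\<And>t. DERIV \<Phi> t :> \<Phi>' t" and bound: "\<And>t. \<bar>\<Phi>' t\<bar> \<le> 1"
    and cont: "continuous_on UNIV \<Phi>'"
    and sm: "\<And>\<phi> :: real^'d \<Rightarrow> real. smooth \<phi> \<Longrightarrow> smooth (\<lambda>x. \<Phi> (\<phi> x))"
  shows "H10_gradient \<Omega> (\<lambda>x. \<Phi> (y x)) (\<lambda>x. \<Phi>' (y x) *\<^sub>R G x)"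
proof -
  let ?M = "lebesgue_on \<Omega>"
  have y: "y \<in> L2 ?M" and G2: "G \<in> L2 ?M" using G by (auto simp: H10_gradient_def)
  have lip: "\<bar>\<Phi> s - \<Phi> t\<bar> \<le> \<bar>s - t\<bar>" for s t
    using field_differentiable_bound[of UNIV \<Phi> \<Phi>' 1 s t] deriv bound by simp
  have [measurable]: "\<Phi> \<in> borel_measurable borel" "\<Phi>' \<in> borel_measurable borel"
    using cont DERIV_continuous_on[of UNIV \<Phi> \<Phi>'] deriv by (auto intro: borel_measurable_continuous_onI)
  have [measurable]: "y \<in> borel_measurable ?M" "G \<in> borel_measurable ?M" using y G2 by (auto simp: L2_def)
  have L: "(\<lambda>x. \<Phi> (y x)) \<in> L2 ?M"
  proof (rule L2_dominated[OF _ L2_D(2)[OF y]])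
    show "AE x in ?M. (norm (\<Phi> (y x)))\<^sup>2 \<le> (norm (y x))\<^sup>2"
      using lip[of _ 0] \<Phi>0 by (intro AE_I2 power_mono) auto
  qed simp
  have LG: "(\<lambda>x. \<Phi>' (y x) *\<^sub>R F x) \<in> L2 ?M" if "F \<in> L2 ?M" "y \<in> borel_measurable ?M"
    for y and F :: "real^'d \<Rightarrow> real^'d"
    using that bound by (intro L2_scaleR_bounded[OF that(1), of _ 1]) auto
  obtain \<phi>0 where \<phi>0: "\<And>n. \<phi>0 n \<in> test_functions \<Omega>"
    and lim0: "(\<lambda>n. L2norm ?M (\<lambda>x. \<phi>0 n x - y x)) \<longlonglongrightarrow> 0"
      "(\<lambda>n. L2norm ?M (\<lambda>x. grad (\<phi>0 n) x - G x)) \<longlonglongrightarrow> 0"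
    using G unfolding H10_gradient_def by blast
  have "integrable ?M (\<lambda>x. (\<phi>0 n x - y x)\<^sup>2)" for n
    using L2_D(2)[OF L2_diff[OF test_functions_L2(1)[OF \<Omega> \<phi>0] y], of n] by simp
  moreover have "(\<lambda>n. LINT x|?M. norm ((\<phi>0 n x - y x)\<^sup>2)) \<longlonglongrightarrow> 0"
    using L2norm_tendsto_0D[OF lim0(1)] by simp
  ultimately obtain s where s: "strict_mono s" and ae: "AE x in ?M. (\<lambda>n. (\<phi>0 (s n) x - y x)\<^sup>2) \<longlonglongrightarrow> 0"
    using tendsto_L1_AE_subseq[of ?M "\<lambda>n x. (\<phi>0 n x - y x)\<^sup>2"] by auto
  define \<phi> where "\<phi> n = \<phi>0 (s n)" for n
  have \<phi>: "\<phi> n \<in> test_functions \<Omega>" for n by (simp add: \<phi>_def \<phi>0)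
  have lim: "(\<lambda>n. L2norm ?M (\<lambda>x. \<phi> n x - y x)) \<longlonglongrightarrow> 0"
      "(\<lambda>n. L2norm ?M (\<lambda>x. grad (\<phi> n) x - G x)) \<longlonglongrightarrow> 0"
    using LIMSEQ_subseq_LIMSEQ[OF lim0(1) s] LIMSEQ_subseq_LIMSEQ[OF lim0(2) s]
    by (simp_all add: \<phi>_def comp_def)
  note L2\<phi> = test_functions_L2[OF \<Omega> \<phi>]
  have [measurable]: "\<phi> n \<in> borel_measurable ?M" for n using L2\<phi>(1) by (auto simp: L2_def)
  have t: "(\<lambda>x. \<Phi> (\<phi> n x)) \<in> test_functions \<Omega>" for n
    by (rule test_functionsI[OF sm[OF test_functions_smooth[OF \<phi>]] \<phi>[of n]]) (simp add: \<Phi>0)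
  have g: "grad (\<lambda>x. \<Phi> (\<phi> n x)) x = \<Phi>' (\<phi> n x) *\<^sub>R grad (\<phi> n) x" for n x
    by (intro grad_eq GDERIV_DERIV_compose deriv smooth_GDERIV test_functions_smooth[OF \<phi>])
  have l1: "(\<lambda>n. L2norm ?M (\<lambda>x. \<Phi> (\<phi> n x) - \<Phi> (y x))) \<longlonglongrightarrow> 0"
    by (rule L2norm_tendsto_0_mono[OF lim(1)])
      (auto simp: lip intro: L2_diff[OF L2\<phi>(1) y])
  have "(\<lambda>n. L2norm ?M (\<lambda>x. \<Phi>' (\<phi> n x) *\<^sub>R (grad (\<phi> n) x - G x) + (\<Phi>' (\<phi> n x) - \<Phi>' (y x)) *\<^sub>R G x)) \<longlonglongrightarrow> 0"
  proof (rule L2norm_tendsto_0_add)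
    show d: "(\<lambda>x. \<Phi>' (\<phi> n x) *\<^sub>R (grad (\<phi> n) x - G x)) \<in> L2 ?M" for n
      by (intro LG L2_diff L2\<phi> G2) simp
    show "(\<lambda>x. (\<Phi>' (\<phi> n x) - \<Phi>' (y x)) *\<^sub>R G x) \<in> L2 ?M" for n
      using L2_diff[OF LG[OF G2, of "\<phi> n"] LG[OF G2, of y]] by (simp add: scaleR_diff_left)
    show "(\<lambda>n. L2norm ?M (\<lambda>x. \<Phi>' (\<phi> n x) *\<^sub>R (grad (\<phi> n) x - G x))) \<longlonglongrightarrow> 0"
    proof (rule L2norm_tendsto_0_mono[OF lim(2)])
      show "AE x in ?M. norm (\<Phi>' (\<phi> n x) *\<^sub>R (grad (\<phi> n) x - G x)) \<le> norm (grad (\<phi> n) x - G x)" for n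
        using bound by (intro AE_I2) (simp add: mult_left_le_one_le)
    qed (use d L2_diff[OF L2\<phi>(2) G2] in \<open>auto dest: L2_D(1)\<close>)
    show "(\<lambda>n. L2norm ?M (\<lambda>x. (\<Phi>' (\<phi> n x) - \<Phi>' (y x)) *\<^sub>R G x)) \<longlonglongrightarrow> 0"
    proof (rule L2norm_dominated_convergence[where g = "\<lambda>x. 4 * (norm (G x))\<^sup>2"])
      show "integrable ?M (\<lambda>x. 4 * (norm (G x))\<^sup>2)" using L2_D(2)[OF G2] by simp
      show "AE x in ?M. (\<lambda>n. (\<Phi>' (\<phi> n x) - \<Phi>' (y x)) *\<^sub>R G x) \<longlonglongrightarrow> 0"
        using ae
      proof eventually_elim
        case (elim x)
        from tendsto_real_sqrt[OF elim] have "(\<lambda>n. \<bar>\<phi> n x - y x\<bar>) \<longlonglongrightarrow> 0" by (simp add: \<phi>_def)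
        then have "(\<lambda>n. \<phi> n x) \<longlonglongrightarrow> y x" by (simp add: tendsto_rabs_zero_iff LIM_zero_iff)
        moreover have "isCont \<Phi>' (y x)" using cont by (simp add: continuous_on_eq_continuous_at)
        ultimately have "(\<lambda>n. \<Phi>' (\<phi> n x)) \<longlonglongrightarrow> \<Phi>' (y x)" by (rule isCont_tendsto_compose[rotated])
        then have "(\<lambda>n. (\<Phi>' (\<phi> n x) - \<Phi>' (y x)) *\<^sub>R G x) \<longlonglongrightarrow> 0 *\<^sub>R G x"
          by (intro tendsto_scaleR tendsto_const) (simp add: LIM_zero)
        then show ?case by simp
      qed
      show "AE x in ?M. (norm ((\<Phi>' (\<phi> n x) - \<Phi>' (y x)) *\<^sub>R G x))\<^sup>2 \<le> 4 * (norm (G x))\<^sup>2" for n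
      proof (rule AE_I2)
        fix x
        have "\<bar>\<Phi>' (\<phi> n x) - \<Phi>' (y x)\<bar> \<le> 2" using bound[of "\<phi> n x"] bound[of "y x"] by linarith
        then have "(\<Phi>' (\<phi> n x) - \<Phi>' (y x))\<^sup>2 \<le> 4"
          using power_mono[of "\<bar>\<Phi>' (\<phi> n x) - \<Phi>' (y x)\<bar>" 2 2] by simp
        then show "(norm ((\<Phi>' (\<phi> n x) - \<Phi>' (y x)) *\<^sub>R G x))\<^sup>2 \<le> 4 * (norm (G x))\<^sup>2"
          by (simp add: power_mult_distrib mult_right_mono)
      qed
    qed simp
  qed
  then have l2: "(\<lambda>n. L2norm ?M (\<lambda>x. grad (\<lambda>x. \<Phi> (\<phi> n x)) x - \<Phi>' (y x) *\<^sub>R G x)) \<longlonglongrightarrow> 0"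
    by (simp add: g scaleR_diff_left scaleR_diff_right)
  show ?thesis
    using L LG[OF G2] t l1 l2 unfolding H10_gradient_def
    by (auto intro!: exI[of _ "\<lambda>n x. \<Phi> (\<phi> n x)"])
qed

section \<open>A smooth approximation of the positive part\<close>

definition logistic :: "real \<Rightarrow> real \<Rightarrow> real \<Rightarrow> real" where
  "logistic k M t = exp (k * (t - M)) / (1 + exp (k * (t - M)))"

text \<open>Shifted by a constant such that it vanishes at \<open>0\<close> and so preserves compact supports. As
  \<open>k \<rightarrow> \<infinity>\<close> it tends to \<open>max 0 (t - M)\<close> for \<open>M \<ge> 0\<close>.\<close>

definition softplus :: "real \<Rightarrow> real \<Rightarrow> real \<Rightarrow> real" where
  "softplus k M t = (ln (1 + exp (k * (t - M))) - ln (1 + exp (- (k * M)))) / k"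

lemma one_plus_exp_pos: "0 < 1 + exp (x::real)"
  using exp_gt_zero[of x] by linarith

lemma logistic_bounds: "0 \<le> logistic k M t" "logistic k M t \<le> 1"
  unfolding logistic_def using one_plus_exp_pos[of "k * (t - M)"] by (auto simp: divide_simps)

lemma DERIV_logistic: "DERIV (logistic k M) t :> k * (logistic k M t * (1 - logistic k M t))"
proof -
  have "1 + exp (k * (t - M)) \<noteq> 0" using one_plus_exp_pos[of "k * (t - M)"] by linarith
  then show ?thesis
    unfolding logistic_def[abs_def]
    by (auto intro!: derivative_eq_intros simp: divide_simps) (simp add: algebra_simps power2_eq_square)
qed

lemma DERIV_softplus:
  assumes "k \<noteq> 0"
  shows "DERIV (softplus k M) t :> logistic k M t"
  unfolding logistic_def softplus_def[abs_def]
  using assms one_plus_exp_pos[of "k * (t - M)"]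
  by (auto intro!: derivative_eq_intros simp: divide_simps)

text \<open>The logistic function satisfies \<open>l' = k * l * (1 - l)\<close>. Hence polynomials in it are closed under
  differentiation, which makes the induction work for all polynomials simultaneously.\<close>

lemma Ck_poly_logistic: "smooth \<phi> \<Longrightarrow> Ck n (\<lambda>x. poly p (logistic k M (\<phi> x)))"
proof (induction n arbitrary: p)
  case 0
  have "continuous_on UNIV (logistic k M)"
    using DERIV_logistic by (rule DERIV_continuous_on)
  then have "continuous_on UNIV (\<lambda>x. logistic k M (\<phi> x))"
    using smooth_continuous[OF 0] by (rule continuous_on_compose2) auto
  then show ?case by (simp add: continuous_on_poly)
next
  case (Suc n)
  let ?q = "smult k ([:0, 1, -1:] * pderiv p)"
  have "DERIV (\<lambda>t. poly p (logistic k M t)) t :> poly ?q (logistic k M t)" for t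
    using DERIV_chain2[OF poly_DERIV DERIV_logistic, of p k M t] by (simp add: algebra_simps)
  then have g: "GDERIV (\<lambda>x. poly p (logistic k M (\<phi> x))) x :> poly ?q (logistic k M (\<phi> x)) *\<^sub>R grad \<phi> x" for x
    using GDERIV_DERIV_compose[OF smooth_GDERIV[OF Suc.prems]] by blast
  have "Ck n (\<lambda>x. grad \<phi> x $ i)" for i
    using smooth_grad_nth[OF Suc.prems] by (simp add: smooth_def)
  then have c: "Ck n (\<lambda>x. (poly ?q (logistic k M (\<phi> x)) *\<^sub>R grad \<phi> x) $ i)" for i
    using Ck_mult[OF Suc.IH[OF Suc.prems, of ?q]] by (simp del: poly_smult poly_mult)
  show ?case
    unfolding Ck.simps using g c by (intro exI conjI allI)
qed

lemma smooth_softplus: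
  assumes "k \<noteq> 0" "smooth \<phi>"
  shows "smooth (\<lambda>x. softplus k M (\<phi> x))"
  unfolding smooth_def
proof
  fix n
  have g: "GDERIV (\<lambda>x. softplus k M (\<phi> x)) x :> logistic k M (\<phi> x) *\<^sub>R grad \<phi> x" for x
    by (intro GDERIV_DERIV_compose DERIV_softplus smooth_GDERIV assms)
  have "Ck n (\<lambda>x. grad \<phi> x $ i)" for i
    using smooth_grad_nth[OF assms(2)] by (simp add: smooth_def)
  then have c: "Ck n (\<lambda>x. (logistic k M (\<phi> x) *\<^sub>R grad \<phi> x) $ i)" for i
    using Ck_mult[OF Ck_poly_logistic[OF assms(2), of n "[:0, 1:]" k M]] by simp
  have "Ck (Suc n) (\<lambda>x. softplus k M (\<phi> x))"
    unfolding Ck.simps using g c by (intro exI conjI allI)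
  then show "Ck n (\<lambda>x. softplus k M (\<phi> x))" by (rule Ck_SucD)
qed

lemma softplus_0: "softplus k M 0 = 0"
  by (simp add: softplus_def)

lemma abs_softplus_le:
  assumes "k \<noteq> 0"
  shows "\<bar>softplus k M t\<bar> \<le> \<bar>t\<bar>"
  using field_differentiable_bound[of UNIV "softplus k M" "logistic k M" 1 t 0]
    DERIV_softplus[OF assms] logistic_bounds by (simp add: softplus_0)

lemma ln_one_plus_exp_bounds: "\<bar>ln (1 + exp x) - max 0 x\<bar> \<le> ln (2::real)"
proof -
  have "exp (max 0 x) \<le> 1 + exp x" by (simp add: max_def)
  then have "max 0 x \<le> ln (1 + exp x)" using one_plus_exp_pos[of x] by (simp add: ln_ge_iff)
  moreover have "ln (1 + exp x) \<le> ln (2 * exp (max 0 x))"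
    using one_plus_exp_pos[of x] by (subst ln_le_cancel_iff) (auto simp: max_def)
  then have "ln (1 + exp x) \<le> ln 2 + max 0 x" by (simp add: ln_mult)
  ultimately show ?thesis by linarith
qed

text \<open>Each of the two logarithms differs from the maximum by at most \<open>ln 2\<close>, and the second maximum
  is \<open>0\<close> as \<open>M \<ge> 0\<close>.\<close>

lemma softplus_approx:
  assumes "0 < k" "0 \<le> M"
  shows "\<bar>softplus k M t - max 0 (t - M)\<bar> \<le> 2 * ln 2 / k"
proof -
  have m: "k * max 0 (t - M) = max 0 (k * (t - M))" "max 0 (- (k * M)) = 0"
    using assms by (auto simp: max_def zero_le_mult_iff mult_le_0_iff)
  have s: "k * softplus k M t = ln (1 + exp (k * (t - M))) - ln (1 + exp (- (k * M)))"
    using assms by (simp add: softplus_def)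
  have "k * (softplus k M t - max 0 (t - M))
      = (ln (1 + exp (k * (t - M))) - max 0 (k * (t - M))) - (ln (1 + exp (- (k * M))) - max 0 (- (k * M)))"
    by (simp only: right_diff_distrib[of k "softplus k M t"] s m)
  then have "\<bar>k * (softplus k M t - max 0 (t - M))\<bar> \<le> 2 * ln 2"
    using ln_one_plus_exp_bounds[of "k * (t - M)"] ln_one_plus_exp_bounds[of "- (k * M)"] by linarith
  then show ?thesis using assms(1) by (simp only: abs_mult) (simp add: field_simps)
qed

lemma softplus_tendsto:
  assumes "0 \<le> M"
  shows "(\<lambda>n. softplus (real (Suc n)) M t) \<longlonglongrightarrow> max 0 (t - M)"
proof (rule LIM_zero_cancel, rule Lim_null_comparison)
  show "\<forall>\<^sub>F n in sequentially. norm (softplus (real (Suc n)) M t - max 0 (t - M)) \<le> 2 * ln 2 * inverse (real (Suc n))"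
    using softplus_approx[of "real (Suc n)" M t for n] assms
    by (intro always_eventually) (simp add: divide_inverse)
  show "(\<lambda>n. 2 * ln 2 * inverse (real (Suc n))) \<longlonglongrightarrow> 0"
    using tendsto_mult[OF tendsto_const LIMSEQ_inverse_real_of_nat] by simp
qed

section \<open>The maximum principle\<close>

text \<open>The test functions \<open>v\<^sub>n\<close> are softplus functions of \<open>w\<close> with slopes \<open>l\<^sub>n \<in> [0, 1]\<close>, so
  \<open>\<bar>\<nabla>v\<^sub>n\<bar>\<^sup>2 = l\<^sub>n\<^sup>2 * \<bar>G\<bar>\<^sup>2 \<le> G \<bullet> \<nabla>v\<^sub>n\<close>. With the Poincare inequality and the equation,
  \<open>\<integral> v\<^sub>n\<^sup>2 \<le> - C * \<integral> h * v\<^sub>n\<close>. In the limit \<open>v\<^sub>n\<close> becomes the positive part \<open>p\<close> of \<open>w - M\<close>, for which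
  \<open>h * p \<ge> 0\<close>.\<close>

lemma weak_maximum_principle:
  assumes \<Omega>: "bounded_domain \<Omega>" and G: "H10_gradient \<Omega> w G"
    and h: "h \<in> L2 (lebesgue_on \<Omega>)" and "0 \<le> M"
    and weak: "\<And>v V. H10_gradient \<Omega> v V \<Longrightarrow>
      (LINT x|lebesgue_on \<Omega>. G x \<bullet> V x) + (LINT x|lebesgue_on \<Omega>. h x * v x) = 0"
    and sign: "AE x in lebesgue_on \<Omega>. M < w x \<longrightarrow> 0 \<le> h x"
  shows "AE x in lebesgue_on \<Omega>. w x \<le> M"
proof -
  let ?M = "lebesgue_on \<Omega>"
  note \<Omega>' = bounded_domain_lmeasurable[OF \<Omega>]
  obtain R where R: "\<And>x. x \<in> \<Omega> \<Longrightarrow> norm x \<le> R"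
    using \<Omega> unfolding bounded_domain_def bounded_iff by blast
  have w: "w \<in> L2 ?M" and G2: "G \<in> L2 ?M" using G by (auto simp: H10_gradient_def)
  have [measurable]: "w \<in> borel_measurable ?M" "h \<in> borel_measurable ?M" using w h by (auto simp: L2_def)
  define v where "v n x = softplus (real (Suc n)) M (w x)" for n x
  define V where "V n x = logistic (real (Suc n)) M (w x) *\<^sub>R G x" for n x
  define p where "p x = max 0 (w x - M)" for x
  have vV: "H10_gradient \<Omega> (v n) (V n)" for n
    unfolding v_def V_def
  proof (rule H10_gradient_compose[OF \<Omega>' G, of "softplus (real (Suc n)) M" "logistic (real (Suc n)) M"])
    show "(softplus (real (Suc n)) M has_real_derivative logistic (real (Suc n)) M t) (at t)" for t
      by (rule DERIV_softplus) simp
    show "\<bar>logistic (real (Suc n)) M t\<bar> \<le> 1" for t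
      using logistic_bounds[of "real (Suc n)" M t] by simp
    show "continuous_on UNIV (logistic (real (Suc n)) M)"
      using DERIV_logistic by (rule DERIV_continuous_on)
  qed (simp_all add: softplus_0 smooth_softplus del: of_nat_Suc)
  have v: "v n \<in> L2 ?M" and V: "V n \<in> L2 ?M" for n using vV[of n] by (auto simp: H10_gradient_def)
  have v_le: "\<bar>v n x\<bar> \<le> \<bar>w x\<bar>" for n x unfolding v_def by (rule abs_softplus_le) simp
  have lim: "(\<lambda>n. v n x) \<longlonglongrightarrow> p x" for x
    unfolding v_def p_def using \<open>0 \<le> M\<close> by (rule softplus_tendsto)
  have energy: "(LINT x|?M. (v n x)\<^sup>2) \<le> 4 * R\<^sup>2 * - (LINT x|?M. h x * v n x)" for n
  proof -
    have "(LINT x|?M. (norm (V n x))\<^sup>2) \<le> (LINT x|?M. G x \<bullet> V n x)"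
    proof (rule integral_mono)
      fix x
      let ?l = "logistic (real (Suc n)) M (w x)"
      have "?l\<^sup>2 \<le> ?l"
        using mult_left_mono[OF logistic_bounds(2) logistic_bounds(1), of "real (Suc n)" M "w x"]
        by (simp add: power2_eq_square)
      then have "?l\<^sup>2 * (norm (G x))\<^sup>2 \<le> ?l * (norm (G x))\<^sup>2" by (rule mult_right_mono) simp
      then show "(norm (V n x))\<^sup>2 \<le> G x \<bullet> V n x"
        unfolding V_def by (simp add: power_mult_distrib power2_norm_eq_inner)
    qed (use V G2 in \<open>auto intro: L2_inner_integrable L2_D\<close>)
    also have "\<dots> = - (LINT x|?M. h x * v n x)" using weak[OF vV[of n]] by simp
    finally have "4 * R\<^sup>2 * (LINT x|?M. (norm (V n x))\<^sup>2) \<le> 4 * R\<^sup>2 * - (LINT x|?M. h x * v n x)"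
      by (rule mult_left_mono) simp
    then show ?thesis using poincare_inequality[OF \<Omega>' R vV[of n]] by simp
  qed
  have pint: "integrable ?M (\<lambda>x. (p x)\<^sup>2)"
  proof (rule Bochner_Integration.integrable_bound[OF L2_D(2)[OF w]])
    show "AE x in ?M. norm ((p x)\<^sup>2) \<le> norm ((norm (w x))\<^sup>2)"
    proof (rule AE_I2)
      fix x
      have "\<bar>p x\<bar> \<le> \<bar>w x\<bar>" using \<open>0 \<le> M\<close> by (auto simp: p_def)
      from power_mono[OF this, of 2] show "norm ((p x)\<^sup>2) \<le> norm ((norm (w x))\<^sup>2)" by simp
    qed
  qed (simp add: p_def)
  have 1: "(\<lambda>n. LINT x|?M. (v n x)\<^sup>2) \<longlonglongrightarrow> (LINT x|?M. (p x)\<^sup>2)"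
  proof (rule integral_dominated_convergence[where w = "\<lambda>x. (norm (w x))\<^sup>2"])
    show "integrable ?M (\<lambda>x. (norm (w x))\<^sup>2)" by (rule L2_D[OF w])
    show "AE x in ?M. norm ((v n x)\<^sup>2) \<le> (norm (w x))\<^sup>2" for n
      using power_mono[OF v_le, where n = 2] by simp
    show "(\<lambda>x. (v n x)\<^sup>2) \<in> borel_measurable ?M" for n using L2_D(1)[OF v[of n]] by simp
  qed (use lim pint in \<open>auto intro!: tendsto_power\<close>)
  have 2: "(\<lambda>n. LINT x|?M. h x * v n x) \<longlonglongrightarrow> (LINT x|?M. h x * p x)"
  proof (rule integral_dominated_convergence[where w = "\<lambda>x. norm (h x * w x)"])
    show "integrable ?M (\<lambda>x. norm (h x * w x))"
      by (intro Bochner_Integration.integrable_norm L2_mult_integrable h w)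
    show "AE x in ?M. norm (h x * v n x) \<le> norm (h x * w x)" for n
      by (intro AE_I2) (simp add: abs_mult mult_left_mono v_le)
    show "(\<lambda>x. h x * v n x) \<in> borel_measurable ?M" for n using L2_D(1)[OF v[of n]] by simp
    show "AE x in ?M. (\<lambda>n. h x * v n x) \<longlonglongrightarrow> h x * p x"
      using lim by (intro AE_I2 tendsto_mult tendsto_const)
  qed (simp add: p_def)
  have "(LINT x|?M. (p x)\<^sup>2) \<le> 4 * R\<^sup>2 * - (LINT x|?M. h x * p x)"
    by (rule LIMSEQ_le[OF 1 tendsto_mult[OF tendsto_const tendsto_minus[OF 2]]]) (use energy in blast)
  also have "0 \<le> (LINT x|?M. h x * p x)"
    by (rule integral_nonneg_AE) (use sign in eventually_elim, auto simp: p_def max_def)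
  then have "4 * R\<^sup>2 * - (LINT x|?M. h x * p x) \<le> 0" by (simp add: mult_nonneg_nonpos)
  finally have "(LINT x|?M. (p x)\<^sup>2) = 0"
    by (meson antisym Bochner_Integration.integral_nonneg zero_le_power2)
  then have "AE x in ?M. (p x)\<^sup>2 = 0"
    using integral_nonneg_eq_0_iff_AE[OF pint] by simp
  then show ?thesis by eventually_elim (auto simp: p_def)
qed

text \<open>The maximum principle for \<open>y - y\<^sub>P\<close> and for its negative. On the set where
  \<open>y - y\<^sub>P\<close> exceeds \<open>M\<close>, the bound on \<open>y\<^sub>P\<close> makes \<open>y\<close> positive, and then \<open>g(y)\<close> is nonnegative.\<close>

lemma weak_solution_bound:
  assumes \<Omega>: "bounded_domain \<Omega>"
    and y: "weak_solution \<Omega> g f y" and yP: "weak_solution \<Omega> (\<lambda>_. 0) f y\<^sub>P"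
    and g: "(\<lambda>x. g (y x)) \<in> L2 (lebesgue_on \<Omega>)" and sign: "\<And>t. 0 \<le> t * g t"
    and M: "0 \<le> M" "AE x in lebesgue_on \<Omega>. \<bar>y\<^sub>P x\<bar> \<le> M"
  shows "AE x in lebesgue_on \<Omega>. \<bar>y x\<bar> \<le> 2 * M"
proof -
  let ?M = "lebesgue_on \<Omega>"
  note \<Omega>' = bounded_domain_lmeasurable[OF \<Omega>]
  obtain G GP where G: "H10_gradient \<Omega> y G" and GP: "H10_gradient \<Omega> y\<^sub>P GP"
    using y yP unfolding weak_solution_def by (auto simp: H10_iff[OF \<Omega>'])
  have L2: "G \<in> L2 ?M" "GP \<in> L2 ?M" using G GP by (auto simp: H10_gradient_def)
  have w: "H10_gradient \<Omega> (\<lambda>x. y x - y\<^sub>P x) (\<lambda>x. G x - GP x)"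
    using H10_gradient_add[OF \<Omega>' G H10_gradient_uminus[OF GP]] by simp
  have weak: "(LINT x|?M. (G x - GP x) \<bullet> V x) + (LINT x|?M. g (y x) * v x) = 0"
    if V: "H10_gradient \<Omega> v V" for v V
  proof -
    have vH: "v \<in> H10 \<Omega>" using V by (auto simp: H10_iff[OF \<Omega>'])
    have VL: "V \<in> L2 ?M" using V by (auto simp: H10_gradient_def)
    note wg = H10_gradient_weak[OF \<Omega>' G] H10_gradient_weak[OF \<Omega>' GP] H10_gradient_weak[OF \<Omega>' V]
    have "(LINT x|?M. G x \<bullet> V x) + (LINT x|?M. g (y x) * v x) = (LINT x|?M. f x * v x)"
      using y vH wg unfolding weak_solution_def by blast
    moreover have "(LINT x|?M. GP x \<bullet> V x) + (LINT x|?M. 0 * v x) = (LINT x|?M. f x * v x)"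
      using yP vH wg unfolding weak_solution_def by blast
    moreover have "(LINT x|?M. (G x - GP x) \<bullet> V x) = (LINT x|?M. G x \<bullet> V x) - (LINT x|?M. GP x \<bullet> V x)"
      using L2 VL by (simp add: inner_diff_left L2_inner_integrable)
    ultimately show ?thesis by simp
  qed
  have "AE x in ?M. y x - y\<^sub>P x \<le> M"
  proof (rule weak_maximum_principle[OF \<Omega> w g M(1) weak])
    show "AE x in ?M. M < y x - y\<^sub>P x \<longrightarrow> 0 \<le> g (y x)"
      using M(2)
    proof eventually_elim
      case (elim x)
      then show ?case using sign[of "y x"] by (auto simp: zero_le_mult_iff)
    qed
  qed
  moreover have "AE x in ?M. - (y x - y\<^sub>P x) \<le> M"
  proof (rule weak_maximum_principle[OF \<Omega> H10_gradient_uminus[OF w] L2_uminus[OF g] M(1)])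
    show "(LINT x|?M. - (G x - GP x) \<bullet> V x) + (LINT x|?M. - g (y x) * v x) = 0"
      if "H10_gradient \<Omega> v V" for v V
      using weak[OF that] by (simp add: inner_minus_left del: minus_diff_eq)
    show "AE x in ?M. M < - (y x - y\<^sub>P x) \<longrightarrow> 0 \<le> - g (y x)"
      using M(2)
    proof eventually_elim
      case (elim x)
      then show ?case using sign[of "y x"] by (auto simp: zero_le_mult_iff)
    qed
  qed
  ultimately show ?thesis using M(2) by eventually_elim linarith
qed

section \<open>The superposition operator\<close>

lemma nemytskii_eq:
  "nemytskii u t = (if 0 \<le> t then LINT s|lebesgue. indicator {0<..<t} s * u s
     else - (LINT s|lebesgue. indicator {t<..<0} s * u s))"
proof -
  have "einterval 0 (ereal t) = {0<..<t}" "einterval (ereal t) 0 = {t<..<0}"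
    by (simp_all add: zero_ereal_def)
  then show ?thesis
    by (simp add: nemytskii_def interval_lebesgue_integral_def set_lebesgue_integral_def)
qed

lemma indicator_L2: "A \<in> lmeasurable \<Longrightarrow> (indicator A :: 'a::euclidean_space \<Rightarrow> real) \<in> L2 lebesgue"
  by (rule L2_dominated[where g = "indicator A"])
    (auto simp: indicator_def fmeasurable_def intro!: integrable_real_indicator)

lemma L2_indicator_integrable:
  "u \<in> L2 lebesgue \<Longrightarrow> A \<in> lmeasurable \<Longrightarrow> integrable lebesgue (\<lambda>s. indicator A s * u s :: real)"
  by (intro L2_mult_integrable indicator_L2)

lemma nemytskii_0: "nemytskii u 0 = 0"
  by (simp add: nemytskii_eq)

lemma nemytskii_mono:
  assumes u: "u \<in> L2 lebesgue" "AE s in lebesgue. 0 \<le> u s"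
  shows "mono (nemytskii u)"
proof -
  have *: "(LINT s|lebesgue. indicator A s * u s) \<le> (LINT s|lebesgue. indicator B s * u s)"
    if "A \<subseteq> B" "A \<in> lmeasurable" "B \<in> lmeasurable" for A B
  proof (rule integral_mono_AE)
    show "AE s in lebesgue. indicator A s * u s \<le> indicator B s * u s"
      using u(2) by eventually_elim (use that(1) in \<open>auto simp: indicator_def\<close>)
  qed (use that u in \<open>auto intro: L2_indicator_integrable\<close>)
  have nonneg: "0 \<le> (LINT s|lebesgue. indicator A s * u s)" for A
    by (rule integral_nonneg_AE) (use u(2) in eventually_elim, auto simp: indicator_def)
  show ?thesis
  proof (rule monoI)
    fix s t :: real
    assume "s \<le> t"
    then have "{0<..<s} \<subseteq> {0<..<t}" "{t<..<0} \<subseteq> {s<..<0}" by auto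
    then show "nemytskii u s \<le> nemytskii u t"
      using \<open>s \<le> t\<close> *[of "{0<..<s}" "{0<..<t}"] *[of "{t<..<0}" "{s<..<0}"] nonneg[of "{0<..<t}"] nonneg[of "{s<..<0}"]
      by (auto simp: nemytskii_eq)
  qed
qed

text \<open>Linear growth, from \<open>2 * \<bar>u\<bar> \<le> 1 + u\<^sup>2\<close>. It makes the superposition operator map
  \<open>L\<^sup>2(\<Omega>)\<close> into itself.\<close>

lemma nemytskii_bound:
  assumes u: "u \<in> L2 lebesgue"
  shows "\<bar>nemytskii u t\<bar> \<le> (\<bar>t\<bar> + (LINT s|lebesgue. (u s)\<^sup>2)) / 2"
proof -
  have int: "integrable lebesgue (\<lambda>s. (u s)\<^sup>2)" using L2_D(2)[OF u] by simp
  have *: "\<bar>LINT s|lebesgue. indicator A s * u s\<bar> \<le> (measure lebesgue A + (LINT s|lebesgue. (u s)\<^sup>2)) / 2"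
    if A: "A \<in> lmeasurable" for A
  proof -
    have intA: "integrable lebesgue (indicator A :: real \<Rightarrow> real)"
      using A by (auto simp: fmeasurable_def intro!: integrable_real_indicator)
    have "\<bar>LINT s|lebesgue. indicator A s * u s\<bar> \<le> (LINT s|lebesgue. (indicator A s + (u s)\<^sup>2) / 2)"
    proof (rule integral_abs_bound[THEN order_trans], rule integral_mono)
      show "integrable lebesgue (\<lambda>s. \<bar>indicator A s * u s\<bar>)"
        using L2_indicator_integrable[OF u A] by simp
      show "integrable lebesgue (\<lambda>s. (indicator A s + (u s)\<^sup>2) / 2)" using int intA by simp
      fix s
      have "2 * \<bar>u s\<bar> \<le> 1 + (u s)\<^sup>2" using sum_squares_bound[of 1 "\<bar>u s\<bar>"] by simp
      then show "\<bar>indicator A s * u s\<bar> \<le> (indicator A s + (u s)\<^sup>2) / 2"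
        by (auto simp: indicator_def)
    qed
    also have "\<dots> = (measure lebesgue A + (LINT s|lebesgue. (u s)\<^sup>2)) / 2"
      using int intA by simp
    finally show ?thesis .
  qed
  show ?thesis
    using *[of "{0<..<t}"] *[of "{t<..<0}"] by (auto simp: nemytskii_eq)
qed

text \<open>The bound \<open>max 0 r\<close> allows for a negative \<open>r\<close>, where only \<open>t = 0\<close> is left.\<close>

lemma nemytskii_cong:
  assumes "u \<in> L2 lebesgue" "u' \<in> L2 lebesgue"
    and eq: "AE s in lebesgue. s \<in> {-r<..<r} \<longrightarrow> u s = u' s" and t: "\<bar>t\<bar> \<le> max 0 r"
  shows "nemytskii u t = nemytskii u' t"
proof -
  have "(LINT s|lebesgue. indicator A s * u s) = (LINT s|lebesgue. indicator A s * u' s)"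
    if A: "A \<subseteq> {-r<..<r}" "A \<in> lmeasurable" for A
  proof (rule integral_cong_AE)
    show "AE s in lebesgue. indicator A s * u s = indicator A s * u' s"
      using eq by eventually_elim (use A in \<open>auto simp: indicator_def\<close>)
  qed (use assms A in \<open>auto dest: L2_indicator_integrable\<close>)
  moreover have "{0<..<t} \<subseteq> {-r<..<r}" if "0 \<le> t" using t that by (auto simp: max_def split: if_splits)
  moreover have "{t<..<0} \<subseteq> {-r<..<r}" if "\<not> 0 \<le> t" using t that by (auto simp: max_def split: if_splits)
  ultimately show ?thesis by (simp add: nemytskii_eq)
qed

lemma nemytskii_L2:
  assumes \<Omega>: "\<Omega> \<in> lmeasurable" and y: "y \<in> L2 (lebesgue_on \<Omega>)"
    and u: "u \<in> L2 lebesgue" "AE s in lebesgue. 0 \<le> u s"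
  shows "(\<lambda>x. nemytskii u (y x)) \<in> L2 (lebesgue_on \<Omega>)"
proof -
  define K where "K = (LINT s|lebesgue. (u s)\<^sup>2)"
  interpret finite_measure "lebesgue_on \<Omega>" using \<Omega> by (rule finite_measure_lebesgue_on)
  show ?thesis
  proof (rule L2_dominated)
    show "(\<lambda>x. nemytskii u (y x)) \<in> borel_measurable (lebesgue_on \<Omega>)"
      using borel_measurable_mono[OF nemytskii_mono[OF u]] L2_D(1)[OF y]
      by (rule measurable_compose[rotated])
    show "integrable (lebesgue_on \<Omega>) (\<lambda>x. (y x)\<^sup>2 + K\<^sup>2)" using L2_D(2)[OF y] by simp
    show "AE x in lebesgue_on \<Omega>. (norm (nemytskii u (y x)))\<^sup>2 \<le> (y x)\<^sup>2 + K\<^sup>2"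
    proof (rule AE_I2)
      fix x
      have "(norm (nemytskii u (y x)))\<^sup>2 \<le> ((\<bar>y x\<bar> + K) / 2)\<^sup>2"
        using nemytskii_bound[OF u(1)] unfolding K_def by (intro power_mono) auto
      also have "\<dots> \<le> (y x)\<^sup>2 + K\<^sup>2"
      proof -
        have "(\<bar>y x\<bar> + K)\<^sup>2 \<le> 2 * (y x)\<^sup>2 + 2 * K\<^sup>2"
          using norm_add_sq_le[of "\<bar>y x\<bar>" K] by simp
        then have "(\<bar>y x\<bar> + K)\<^sup>2 \<le> 4 * ((y x)\<^sup>2 + K\<^sup>2)"
          using zero_le_power2[of "y x"] zero_le_power2[of K] unfolding distrib_left by linarith
        then show ?thesis by (simp add: power_divide)
      qed
      finally show "(norm (nemytskii u (y x)))\<^sup>2 \<le> (y x)\<^sup>2 + K\<^sup>2" .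
    qed
  qed
qed

lemma nemytskii_sign:
  assumes "u \<in> L2 lebesgue" "AE s in lebesgue. 0 \<le> u s"
  shows "0 \<le> t * nemytskii u t"
  using monoD[OF nemytskii_mono[OF assms], of 0 t] monoD[OF nemytskii_mono[OF assms], of t 0]
  by (cases "0 \<le> t") (auto simp: nemytskii_0 zero_le_mult_iff)

text \<open>By \<open>weak_solution_bound\<close> the values of \<open>y\<close> stay in the range in which the two nonlinearities
  coincide, so \<open>y\<close> solves both equations.\<close>

lemma weak_solution_nemytskii_cong:
  assumes \<Omega>: "bounded_domain \<Omega>" and yP: "weak_solution \<Omega> (\<lambda>_. 0) f y\<^sub>P"
    and r: "AE x in lebesgue_on \<Omega>. 2 * \<bar>y\<^sub>P x\<bar> \<le> r"
    and u: "u \<in> L2 lebesgue" "AE s in lebesgue. 0 \<le> u s"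
    and u': "u' \<in> L2 lebesgue" "AE s in lebesgue. 0 \<le> u' s"
    and eq: "AE s in lebesgue. s \<in> {-r<..<r} \<longrightarrow> u s = u' s"
    and y: "weak_solution \<Omega> (nemytskii u) f y"
  shows "weak_solution \<Omega> (nemytskii u') f y"
proof -
  let ?M = "lebesgue_on \<Omega>"
  note \<Omega>' = bounded_domain_lmeasurable[OF \<Omega>]
  have L2: "v \<in> L2 ?M" if "v \<in> H10 \<Omega>" for v
    using that by (auto simp: H10_def has_weak_gradient_def)
  have yL: "y \<in> L2 ?M" using y L2 by (auto simp: weak_solution_def)
  note g = nemytskii_L2[OF \<Omega>' yL u] nemytskii_L2[OF \<Omega>' yL u']
  have "AE x in ?M. \<bar>y x\<bar> \<le> 2 * max 0 (r / 2)"
  proof (rule weak_solution_bound[OF \<Omega> y yP g(1) nemytskii_sign[OF u]])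
    show "AE x in ?M. \<bar>y\<^sub>P x\<bar> \<le> max 0 (r / 2)" using r by eventually_elim auto
  qed simp
  then have ae: "AE x in ?M. nemytskii u (y x) = nemytskii u' (y x)"
    by eventually_elim (rule nemytskii_cong[OF u(1) u'(1) eq], auto simp: max_def)
  have "(LINT x|?M. nemytskii u (y x) * v x) = (LINT x|?M. nemytskii u' (y x) * v x)"
    if "v \<in> H10 \<Omega>" for v
  proof (rule integral_cong_AE)
    show "AE x in ?M. nemytskii u (y x) * v x = nemytskii u' (y x) * v x"
      using ae by eventually_elim simp
  qed (use g L2[OF that] in \<open>auto dest!: L2_D(1)\<close>)
  then show ?thesis using y unfolding weak_solution_def by simp
qed

lemma state_cong:
  assumes "bounded_domain \<Omega>" "weak_solution \<Omega> (\<lambda>_. 0) f y\<^sub>P"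
    and "AE x in lebesgue_on \<Omega>. 2 * \<bar>y\<^sub>P x\<bar> \<le> r"
    and "u \<in> L2 lebesgue" "AE s in lebesgue. 0 \<le> u s"
    and "u' \<in> L2 lebesgue" "AE s in lebesgue. 0 \<le> u' s"
    and eq: "AE s in lebesgue. s \<in> {-r<..<r} \<longrightarrow> u s = u' s"
  shows "state \<Omega> f u = state \<Omega> f u'"
proof -
  have "AE s in lebesgue. s \<in> {-r<..<r} \<longrightarrow> u' s = u s" using eq by eventually_elim auto
  then have "weak_solution \<Omega> (nemytskii u) f = weak_solution \<Omega> (nemytskii u') f"
    using weak_solution_nemytskii_cong[OF assms(1-3)] assms(4-8) by blast
  then show ?thesis by (simp add: state_def)
qed

section \<open>Gluing and restricting square integrable functions\<close>

lemma L2_restrict_iff: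
  assumes "A \<in> sets lebesgue"
  shows "f \<in> L2 (lebesgue_on A) \<longleftrightarrow> (\<lambda>t. indicator A t *\<^sub>R f t) \<in> L2 lebesgue"
proof -
  have "(\<lambda>t. indicator A t *\<^sub>R (norm (f t))\<^sup>2) = (\<lambda>t. (norm (indicator A t *\<^sub>R f t))\<^sup>2)"
    by (auto simp: fun_eq_iff indicator_def)
  then show ?thesis
    using assms integrable_restrict_space[of A lebesgue "\<lambda>t. (norm (f t))\<^sup>2"]
    by (simp add: L2_def borel_measurable_restrict_space_iff)
qed

lemma L2norm_restrict:
  assumes "A \<in> sets lebesgue"
  shows "L2norm (lebesgue_on A) f = L2norm lebesgue (\<lambda>t. indicator A t *\<^sub>R f t)"
proof -
  have "(\<lambda>t. indicator A t *\<^sub>R (norm (f t))\<^sup>2) = (\<lambda>t. (norm (indicator A t *\<^sub>R f t))\<^sup>2)"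
    by (auto simp: fun_eq_iff indicator_def)
  then show ?thesis
    using assms integral_restrict_space[of A lebesgue "\<lambda>t. (norm (f t))\<^sup>2"] by (simp add: L2norm_def)
qed

lemma L2_restrict:
  assumes "A \<in> sets lebesgue" "f \<in> L2 lebesgue"
  shows "f \<in> L2 (lebesgue_on A)"
  unfolding L2_restrict_iff[OF assms(1)]
  using assms by (intro L2_scaleR_bounded[where C = 1]) auto

lemma L2_glue:
  assumes A: "A \<in> sets lebesgue" and v: "v \<in> L2 (lebesgue_on A)" and w: "w \<in> L2 lebesgue"
  shows "(\<lambda>t. if t \<in> A then v t else w t) \<in> L2 lebesgue"
proof -
  have "(\<lambda>t. indicator (- A) t *\<^sub>R w t) \<in> L2 lebesgue"
    using A w by (intro L2_scaleR_bounded[where C = 1]) (auto simp: indicator_def)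
  then have "(\<lambda>t. indicator A t *\<^sub>R v t + indicator (- A) t *\<^sub>R w t) \<in> L2 lebesgue"
    using v unfolding L2_restrict_iff[OF A] by (rule L2_add[rotated])
  moreover have "(\<lambda>t. indicator A t *\<^sub>R v t + indicator (- A) t *\<^sub>R w t) = (\<lambda>t. if t \<in> A then v t else w t)"
    by (auto simp: fun_eq_iff)
  ultimately show ?thesis by simp
qed

lemma AE_lebesgue_on_iff:
  "A \<in> sets lebesgue \<Longrightarrow> (AE t in lebesgue_on A. P t) \<longleftrightarrow> (AE t in lebesgue. t \<in> A \<longrightarrow> P t)"
  by (simp add: AE_restrict_space_iff)

section \<open>The control cost\<close>

definition control_cost :: "real \<Rightarrow> real \<Rightarrow> real \<Rightarrow> real \<Rightarrow> real" where
  "control_cost \<nu>1 \<nu>2 d s = \<nu>1 * s + \<nu>2 / 2 * (s - d)\<^sup>2"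

text \<open>Strong convexity with modulus \<open>\<nu>2\<close>: moving from \<open>s\<close> the fraction \<open>\<theta>\<close> of the way to the minimiser
  \<open>m\<close> over the half line decreases the cost at least by \<open>\<nu>2 / 2 * \<theta> * (s - m)\<^sup>2\<close>. The
  optimality condition of \<open>m\<close> is the sign of the product \<open>(s - m) * ?c\<close>, where \<open>?c\<close> is the derivative
  of the cost at \<open>m\<close>.\<close>

lemma control_cost_decrease:
  assumes "0 < \<nu>2" "0 \<le> s" "0 \<le> \<theta>" "\<theta> \<le> 1" and m: "m = max 0 (d - \<nu>1 / \<nu>2)"
  shows "control_cost \<nu>1 \<nu>2 d (s + \<theta> * (m - s)) + \<nu>2 / 2 * \<theta> * (s - m)\<^sup>2 \<le> control_cost \<nu>1 \<nu>2 d s"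
proof -
  let ?c = "\<nu>1 + \<nu>2 * (m - d)"
  have c: "0 \<le> (s - m) * ?c"
  proof (cases "0 < d - \<nu>1 / \<nu>2")
    case True
    then show ?thesis using assms(1) m by (simp add: field_simps)
  next
    case False
    then have "m = 0" "0 \<le> ?c" using assms(1) m by (auto simp: field_simps)
    then show ?thesis using assms(2) by simp
  qed
  have "control_cost \<nu>1 \<nu>2 d s - control_cost \<nu>1 \<nu>2 d (s + \<theta> * (m - s)) - \<nu>2 / 2 * \<theta> * (s - m)\<^sup>2
      = \<theta> * ((s - m) * ?c) + \<nu>2 / 2 * (\<theta> * (1 - \<theta>)) * (s - m)\<^sup>2"
    unfolding control_cost_def by (simp add: power2_eq_square field_simps)
  also have "0 \<le> \<dots>"
    using assms(1,3,4) by (intro add_nonneg_nonneg mult_nonneg_nonneg[OF assms(3) c]) simp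
  finally show ?thesis by simp
qed

lemma control_cost_nonneg: "0 \<le> \<nu>1 \<Longrightarrow> 0 \<le> \<nu>2 \<Longrightarrow> 0 \<le> s \<Longrightarrow> 0 \<le> control_cost \<nu>1 \<nu>2 d s"
  by (simp add: control_cost_def)

section \<open>Splitting the objective\<close>

locale control_problem =
  fixes \<Omega> :: "(real ^ 'd::finite) set"
    and f y\<^sub>D y\<^sub>P :: "real ^ 'd \<Rightarrow> real"
    and u\<^sub>D :: "real \<Rightarrow> real"
    and \<nu>1 \<nu>2 r :: real
  assumes \<Omega>: "bounded_domain \<Omega>"
    and u\<^sub>D: "u\<^sub>D \<in> L2 lebesgue"
    and \<nu>1: "0 \<le> \<nu>1" and \<nu>2: "0 < \<nu>2"
    and y\<^sub>P: "weak_solution \<Omega> (\<lambda>_. 0) f y\<^sub>P"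
    and r: "AE x in lebesgue_on \<Omega>. 2 * \<bar>y\<^sub>P x\<bar> \<le> r"
begin

abbreviation "I \<equiv> {-r<..<r}"

abbreviation "q t s \<equiv> control_cost \<nu>1 \<nu>2 (u\<^sub>D t) s"

text \<open>The minimiser of \<open>q t\<close> over \<open>[0, \<infinity>)\<close>, by \<open>cost_u_opt_le\<close>.\<close>

definition u_opt :: "real \<Rightarrow> real" where
  "u_opt t = max 0 (u\<^sub>D t - \<nu>1 / \<nu>2)"

definition J :: "(real \<Rightarrow> real) \<Rightarrow> ennreal" where
  "J u = objective \<Omega> y\<^sub>D u\<^sub>D \<nu>1 \<nu>2 (state \<Omega> f u) u"

definition F :: "(real \<Rightarrow> real) \<Rightarrow> real" where
  "F u = objective_r \<Omega> f y\<^sub>D u\<^sub>D \<nu>1 \<nu>2 r u"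

definition tail_cost :: "(real \<Rightarrow> real) \<Rightarrow> ennreal" where
  "tail_cost u = (\<integral>\<^sup>+ t. ennreal (q t (u t)) * indicator (- I) t \<partial>lebesgue)"

definition admissible :: "(real \<Rightarrow> real) \<Rightarrow> bool" where
  "admissible u \<longleftrightarrow> u \<in> L2 lebesgue \<and> (AE t in lebesgue. 0 \<le> u t)"

lemma I_sets: "I \<in> sets lebesgue"
  by simp

lemma measurable_cost:
  "u \<in> borel_measurable lebesgue \<Longrightarrow> (\<lambda>t. q t (u t)) \<in> borel_measurable lebesgue"
  using L2_D(1)[OF u\<^sub>D] by (simp add: control_cost_def)

lemma measurable_ennreal_indicator:
  fixes g :: "real \<Rightarrow> real"
  assumes "g \<in> borel_measurable lebesgue" "A \<in> sets lebesgue"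
  shows "(\<lambda>t. ennreal (g t) * indicator A t) \<in> borel_measurable lebesgue"
  using assms by (intro borel_measurable_times_ennreal borel_measurable_indicator
      measurable_compose[OF assms(1) measurable_ennreal])

lemma u_opt_nonneg: "0 \<le> u_opt t"
  by (simp add: u_opt_def)

lemma u_opt_L2: "u_opt \<in> L2 lebesgue"
proof (rule L2_dominated[OF _ L2_D(2)[OF u\<^sub>D]])
  show "u_opt \<in> borel_measurable lebesgue" using L2_D(1)[OF u\<^sub>D] by (simp add: u_opt_def[abs_def])
  have "\<bar>u_opt t\<bar> \<le> \<bar>u\<^sub>D t\<bar>" for t using divide_nonneg_pos[OF \<nu>1 \<nu>2] unfolding u_opt_def by linarith
  then show "AE t in lebesgue. (norm (u_opt t))\<^sup>2 \<le> (norm (u\<^sub>D t))\<^sup>2" by (intro AE_I2 power_mono) auto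
qed

lemma cost_u_opt_le: "0 \<le> s \<Longrightarrow> q t (u_opt t) \<le> q t s"
proof -
  assume "0 \<le> s"
  then have "q t (s + 1 * (u_opt t - s)) + \<nu>2 / 2 * 1 * (s - u_opt t)\<^sup>2 \<le> q t s"
    by (intro control_cost_decrease[OF \<nu>2 _ _ _ u_opt_def]) auto
  moreover have "0 \<le> \<nu>2 / 2 * 1 * (s - u_opt t)\<^sup>2" using \<nu>2 by simp
  moreover have "s + 1 * (u_opt t - s) = u_opt t" by simp
  ultimately show ?thesis by simp
qed

lemma state_eq_state_r:
  assumes "admissible u"
  shows "state \<Omega> f u = state_r \<Omega> f r u"
  unfolding state_r_def
proof (rule state_cong[OF \<Omega> y\<^sub>P r])
  show "ext0 r u \<in> L2 lebesgue"
    unfolding ext0_def[abs_def] using assms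
    by (intro L2_glue I_sets L2_restrict) (auto simp: admissible_def L2_def)
  show "u \<in> L2 lebesgue" "AE s in lebesgue. 0 \<le> u s" using assms by (auto simp: admissible_def)
  then show "AE s in lebesgue. 0 \<le> ext0 r u s" by (auto simp: ext0_def)
qed (simp add: ext0_def)

lemma cost_integrable_on_I:
  assumes "u \<in> L2 (lebesgue_on I)"
  shows "integrable (lebesgue_on I) (\<lambda>t. q t (u t))"
proof -
  have "(\<lambda>t. 1 :: real) \<in> L2 (lebesgue_on I)" by (rule bounded_L2[of _ _ 1]) auto
  from L2_mult_integrable[OF this assms] have "integrable (lebesgue_on I) u" by simp
  moreover have "integrable (lebesgue_on I) (\<lambda>t. (u t - u\<^sub>D t)\<^sup>2)"
    using L2_D(2)[OF L2_diff[OF assms L2_restrict[OF I_sets u\<^sub>D]]] by simp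
  ultimately show ?thesis by (simp add: control_cost_def)
qed

lemma F_nonneg:
  assumes "AE t in lebesgue_on I. 0 \<le> u t"
  shows "0 \<le> F u"
proof -
  have "0 \<le> (LINT t|lebesgue_on I. \<nu>1 * u t + \<nu>2 / 2 * (u t - u\<^sub>D t)\<^sup>2)"
    by (rule integral_nonneg_AE) (use assms in eventually_elim, use \<nu>1 \<nu>2 in simp)
  then show ?thesis by (simp add: F_def objective_r_def)
qed

text \<open>For nonnegative controls the \<open>L\<^sup>1\<close>-term and the quadratic term combine into one integral of
  \<open>q\<close>, which is divided at the boundary of the interval. Only the tail can be infinite, since
  square integrable functions are integrable on the bounded interval.\<close>

lemma J_split:
  assumes u: "admissible u"
  shows "J u = ennreal (F u) + tail_cost u"
proof -
  have uL: "u \<in> L2 lebesgue" and pos: "AE t in lebesgue. 0 \<le> u t" using u by (auto simp: admissible_def)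
  have [measurable]: "u \<in> borel_measurable lebesgue" "u\<^sub>D \<in> borel_measurable lebesgue"
    using uL u\<^sub>D by (auto simp: L2_def)
  have [measurable]: "(\<lambda>t. q t (u t)) \<in> borel_measurable lebesgue"
    by (rule measurable_cost) simp
  let ?A = "1 / 2 * (L2norm (lebesgue_on \<Omega>) (\<lambda>x. state \<Omega> f u x - y\<^sub>D x))\<^sup>2"
  have posI: "AE t in lebesgue_on I. 0 \<le> q t (u t)"
    unfolding AE_lebesgue_on_iff[OF I_sets]
    using pos by eventually_elim (use \<nu>1 \<nu>2 in \<open>auto simp: control_cost_nonneg\<close>)
  have "ennreal \<nu>1 * (\<integral>\<^sup>+ t. ennreal \<bar>u t\<bar> \<partial>lebesgue) = (\<integral>\<^sup>+ t. ennreal (\<nu>1 * u t) \<partial>lebesgue)"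
  proof -
    have "ennreal \<nu>1 * (\<integral>\<^sup>+ t. ennreal \<bar>u t\<bar> \<partial>lebesgue) = (\<integral>\<^sup>+ t. ennreal \<nu>1 * ennreal \<bar>u t\<bar> \<partial>lebesgue)"
      by (rule nn_integral_cmult[symmetric]) measurable
    also have "\<dots> = (\<integral>\<^sup>+ t. ennreal (\<nu>1 * u t) \<partial>lebesgue)"
      by (rule nn_integral_cong_AE) (use pos in eventually_elim, simp add: ennreal_mult \<nu>1)
    finally show ?thesis .
  qed
  moreover have "ennreal (\<nu>2 / 2 * (L2norm lebesgue (\<lambda>t. u t - u\<^sub>D t))\<^sup>2)
      = (\<integral>\<^sup>+ t. ennreal (\<nu>2 / 2 * (u t - u\<^sub>D t)\<^sup>2) \<partial>lebesgue)"
  proof -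
    have "integrable lebesgue (\<lambda>t. (u t - u\<^sub>D t)\<^sup>2)" using L2_D(2)[OF L2_diff[OF uL u\<^sub>D]] by simp
    then have "(\<integral>\<^sup>+ t. ennreal (\<nu>2 / 2 * (u t - u\<^sub>D t)\<^sup>2) \<partial>lebesgue)
        = ennreal (LINT t|lebesgue. \<nu>2 / 2 * (u t - u\<^sub>D t)\<^sup>2)"
      using \<nu>2 by (intro nn_integral_eq_integral Bochner_Integration.integrable_mult_right) auto
    then show ?thesis by (simp add: L2norm_sq)
  qed
  moreover have "(\<integral>\<^sup>+ t. ennreal (\<nu>1 * u t) \<partial>lebesgue) + (\<integral>\<^sup>+ t. ennreal (\<nu>2 / 2 * (u t - u\<^sub>D t)\<^sup>2) \<partial>lebesgue)
      = (\<integral>\<^sup>+ t. ennreal (q t (u t)) \<partial>lebesgue)"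
  proof -
    have "(\<integral>\<^sup>+ t. ennreal (\<nu>1 * u t) \<partial>lebesgue) + (\<integral>\<^sup>+ t. ennreal (\<nu>2 / 2 * (u t - u\<^sub>D t)\<^sup>2) \<partial>lebesgue)
      = (\<integral>\<^sup>+ t. ennreal (\<nu>1 * u t) + ennreal (\<nu>2 / 2 * (u t - u\<^sub>D t)\<^sup>2) \<partial>lebesgue)"
      by (rule nn_integral_add[symmetric]) measurable
    also have "\<dots> = (\<integral>\<^sup>+ t. ennreal (q t (u t)) \<partial>lebesgue)"
      by (rule nn_integral_cong_AE)
        (use pos in eventually_elim, use \<nu>1 \<nu>2 in \<open>simp add: control_cost_def ennreal_plus[symmetric] del: ennreal_plus\<close>)
    finally show ?thesis .
  qed
  moreover have "(\<integral>\<^sup>+ t. ennreal (q t (u t)) \<partial>lebesgue)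
      = (\<integral>\<^sup>+ t. ennreal (q t (u t)) * indicator I t \<partial>lebesgue) + tail_cost u"
  proof -
    have "(\<integral>\<^sup>+ t. ennreal (q t (u t)) \<partial>lebesgue)
        = (\<integral>\<^sup>+ t. ennreal (q t (u t)) * indicator I t + ennreal (q t (u t)) * indicator (- I) t \<partial>lebesgue)"
      by (intro nn_integral_cong) (auto simp: indicator_def)
    also have "\<dots> = (\<integral>\<^sup>+ t. ennreal (q t (u t)) * indicator I t \<partial>lebesgue) + tail_cost u"
      unfolding tail_cost_def
      by (intro nn_integral_add measurable_ennreal_indicator measurable_cost) auto
    finally show ?thesis .
  qed
  moreover have "(\<integral>\<^sup>+ t. ennreal (q t (u t)) * indicator I t \<partial>lebesgue)
      = ennreal (LINT t|lebesgue_on I. q t (u t))"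
  proof -
    have "(\<integral>\<^sup>+ t. ennreal (q t (u t)) * indicator I t \<partial>lebesgue) = (\<integral>\<^sup>+ t. ennreal (q t (u t)) \<partial>lebesgue_on I)"
      by (rule nn_integral_restrict_space[symmetric]) simp
    also have "\<dots> = ennreal (LINT t|lebesgue_on I. q t (u t))"
      by (intro nn_integral_eq_integral cost_integrable_on_I L2_restrict I_sets uL posI)
    finally show ?thesis .
  qed
  ultimately have "J u = ennreal ?A + (ennreal (LINT t|lebesgue_on I. q t (u t)) + tail_cost u)"
    unfolding J_def objective_def by (simp add: add.assoc)
  also have "\<dots> = ennreal (?A + (LINT t|lebesgue_on I. q t (u t))) + tail_cost u"
    using integral_nonneg_AE[OF posI] by (simp add: add.assoc[symmetric])
  also have "?A + (LINT t|lebesgue_on I. q t (u t)) = F u"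
    unfolding F_def objective_r_def control_cost_def state_eq_state_r[OF u] ..
  finally show ?thesis .
qed

lemma F_cong:
  assumes "\<And>t. t \<in> I \<Longrightarrow> u t = v t"
  shows "F u = F v"
proof -
  have "ext0 r u = ext0 r v" using assms by (auto simp: ext0_def)
  moreover have "(LINT t|lebesgue_on I. \<nu>1 * u t + \<nu>2 / 2 * (u t - u\<^sub>D t)\<^sup>2)
      = (LINT t|lebesgue_on I. \<nu>1 * v t + \<nu>2 / 2 * (v t - u\<^sub>D t)\<^sup>2)"
    by (rule Bochner_Integration.integral_cong) (auto simp: assms)
  ultimately show ?thesis by (simp add: F_def objective_r_def state_r_def)
qed

lemma tail_cost_cong:
  assumes "AE t in lebesgue. t \<notin> I \<longrightarrow> u t = v t"
  shows "tail_cost u = tail_cost v"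
  unfolding tail_cost_def
  by (rule nn_integral_cong_AE) (use assms in eventually_elim, auto simp: indicator_def)

lemma tail_cost_u_opt_le:
  assumes "AE t in lebesgue. 0 \<le> u t"
  shows "tail_cost u_opt \<le> tail_cost u"
  unfolding tail_cost_def
  by (rule nn_integral_mono_AE)
    (use assms in eventually_elim, auto simp: indicator_def cost_u_opt_le intro!: ennreal_leI)

lemma tail_cost_finite:
  assumes "integrable lebesgue g" "AE t in lebesgue. t \<notin> I \<longrightarrow> q t (u t) \<le> g t"
  shows "tail_cost u < \<infinity>"
proof -
  have "tail_cost u \<le> (\<integral>\<^sup>+ t. ennreal (norm (g t)) \<partial>lebesgue)"
    unfolding tail_cost_def
    by (rule nn_integral_mono_AE)
      (use assms(2) in eventually_elim, auto simp: indicator_def intro!: ennreal_leI)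
  also have "\<dots> < \<infinity>" using assms(1) by (simp add: integrable_iff_bounded)
  finally show ?thesis .
qed

text \<open>Comparison with the control \<open>0\<close>, whose cost is integrable over the whole line.\<close>

lemma cost_u_opt_le_target: "q t (u_opt t) \<le> \<nu>2 / 2 * (u\<^sub>D t)\<^sup>2"
  using cost_u_opt_le[of 0 t] by (simp add: control_cost_def)

lemma target_integrable: "integrable lebesgue (\<lambda>t. \<nu>2 / 2 * (u\<^sub>D t)\<^sup>2)"
  using L2_D(2)[OF u\<^sub>D] by simp

lemma tail_cost_u_opt_finite: "tail_cost u_opt < \<infinity>"
  by (rule tail_cost_finite[OF target_integrable]) (intro AE_I2 impI cost_u_opt_le_target)

definition local_solution :: "ereal \<Rightarrow> (real \<Rightarrow> real) \<Rightarrow> bool" where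
  "local_solution \<rho> ubar \<longleftrightarrow> admissible ubar \<and>
     (\<forall>u. admissible u \<longrightarrow> ereal (L2norm lebesgue (\<lambda>t. u t - ubar t)) \<le> \<rho> \<longrightarrow> J ubar \<le> J u)"

text \<open>The competitor \<open>u n\<close> equals \<open>ubar\<close> on the interval; outside it goes the fraction \<open>lam n\<close> of the way
  from \<open>ubar\<close> to \<open>u_opt\<close>, and all the way where \<open>\<bar>t\<bar> > n\<close>. Beyond \<open>n\<close> it has the finite
  cost of \<open>u_opt\<close>, and up to \<open>n\<close> its cost is bounded by that of \<open>ubar\<close>, which is integrable there; so
  its tail cost is finite even if \<open>ubar\<close> is not integrable. As
  \<open>lam n\<close> tends to \<open>0\<close> pointwise, \<open>u n\<close> lies within the radius of optimality
  for large \<open>n\<close>. Its tail cost is at most that of \<open>ubar\<close> minus the integral of the gap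
  \<open>\<nu>2 / 2 * lam n * (ubar - u_opt)\<^sup>2\<close>, so optimality forces the gap to vanish.\<close>

lemma tail_of_local_solution:
  assumes loc: "local_solution \<rho> ubar" and \<rho>: "0 < \<rho>"
  shows "AE t in lebesgue. t \<notin> I \<longrightarrow> ubar t = u_opt t"
proof -
  have adm: "admissible ubar" using loc by (simp add: local_solution_def)
  then have ubar: "ubar \<in> L2 lebesgue" and pos: "AE t in lebesgue. 0 \<le> ubar t"
    by (auto simp: admissible_def)
  have [measurable]: "ubar \<in> borel_measurable lebesgue" "u_opt \<in> borel_measurable lebesgue"
    "u\<^sub>D \<in> borel_measurable lebesgue"
    using ubar u_opt_L2 u\<^sub>D by (auto simp: L2_def)
  define lam where "lam n t = (if t \<in> I then 0 else if \<bar>t\<bar> \<le> real n then 1 / real (Suc n) else 1)" for n t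
  define u where "u n t = ubar t + lam n t * (u_opt t - ubar t)" for n t
  have lam: "0 \<le> lam n t" "lam n t \<le> 1" for n t by (auto simp: lam_def)
  have [measurable]: "lam n \<in> borel_measurable lebesgue" for n
  proof -
    have "lam n \<in> borel_measurable borel" unfolding lam_def[abs_def] by measurable
    then show ?thesis by (simp add: measurable_completion)
  qed
  have dL: "(\<lambda>t. u_opt t - ubar t) \<in> L2 lebesgue" by (intro L2_diff u_opt_L2 ubar)
  have uL: "u n \<in> L2 lebesgue" for n
  proof -
    have "(\<lambda>t. lam n t *\<^sub>R (u_opt t - ubar t)) \<in> L2 lebesgue"
      using lam by (intro L2_scaleR_bounded[OF dL, of _ 1]) auto
    from L2_add[OF ubar this] show ?thesis by (simp add: u_def[abs_def])
  qed
  have upos: "AE t in lebesgue. 0 \<le> u n t" for n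
    using pos
  proof eventually_elim
    case (elim t)
    have "u n t = (1 - lam n t) * ubar t + lam n t * u_opt t" by (simp add: u_def algebra_simps)
    then show ?case using elim lam[of n t] u_opt_nonneg[of t] by simp
  qed
  have u: "admissible (u n)" for n using uL upos by (simp add: admissible_def)
  have "(\<lambda>n. L2norm lebesgue (\<lambda>t. u n t - ubar t)) \<longlonglongrightarrow> 0"
  proof (rule L2norm_dominated_convergence[OF _ L2_D(2)[OF dL]])
    show "(\<lambda>t. u n t - ubar t) \<in> borel_measurable lebesgue" for n
      using L2_D(1)[OF uL[of n]] by simp
    show "AE t in lebesgue. (norm (u n t - ubar t))\<^sup>2 \<le> (norm (u_opt t - ubar t))\<^sup>2" for n
      using lam by (intro AE_I2 power_mono) (auto simp: u_def abs_mult mult_left_le_one_le)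
    show "AE t in lebesgue. (\<lambda>n. u n t - ubar t) \<longlonglongrightarrow> 0"
    proof (rule AE_I2)
      fix t
      have "(\<lambda>n. lam n t) \<longlonglongrightarrow> 0"
      proof (rule Lim_null_comparison[OF _ LIMSEQ_inverse_real_of_nat])
        show "\<forall>\<^sub>F n in sequentially. norm (lam n t) \<le> inverse (real (Suc n))"
          using eventually_ge_at_top[of "nat \<lceil>\<bar>t\<bar>\<rceil>"]
          by eventually_elim (auto simp: lam_def inverse_eq_divide nat_ceiling_le_eq)
      qed
      then show "(\<lambda>n. u n t - ubar t) \<longlonglongrightarrow> 0"
        using tendsto_mult[OF _ tendsto_const[of "u_opt t - ubar t"]] by (fastforce simp: u_def)
    qed
  qed
  then have "(\<lambda>n. ereal (L2norm lebesgue (\<lambda>t. u n t - ubar t))) \<longlonglongrightarrow> 0"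
    by (simp add: zero_ereal_def)
  from order_tendstoD(2)[OF this \<rho>]
  obtain n where n: "ereal (L2norm lebesgue (\<lambda>t. u n t - ubar t)) < \<rho>"
    by (auto dest: eventually_happens)
  then have "J ubar \<le> J (u n)" using loc u by (auto simp: local_solution_def)
  moreover have "F (u n) = F ubar" by (rule F_cong) (simp add: u_def lam_def)
  ultimately have le: "tail_cost ubar \<le> tail_cost (u n)"
    by (simp add: J_split[OF adm] J_split[OF u] ennreal_add_left_cancel_le)
  have step: "AE t in lebesgue. t \<notin> I \<longrightarrow> 0 \<le> q t (u n t) \<and>
      q t (u n t) + \<nu>2 / 2 * lam n t * (ubar t - u_opt t)\<^sup>2 \<le> q t (ubar t)"
    using pos upos[of n]
  proof eventually_elim
    case (elim t)
    then show ?case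
      using control_cost_decrease[OF \<nu>2 elim(1) lam(1,2) u_opt_def[of t], of n t] control_cost_nonneg[of \<nu>1 \<nu>2 "u n t"] \<nu>1 \<nu>2
      by (auto simp: u_def)
  qed
  have fin: "tail_cost (u n) < \<infinity>"
  proof (rule tail_cost_finite)
    let ?A = "{- real n..real n}"
    let ?g = "\<lambda>t. \<nu>1 * (indicator ?A t * ubar t) + \<nu>2 / 2 * (ubar t - u\<^sub>D t)\<^sup>2 + \<nu>2 / 2 * (u\<^sub>D t)\<^sup>2"
    show "integrable lebesgue ?g"
      using L2_indicator_integrable[OF ubar, of ?A] L2_D(2)[OF L2_diff[OF ubar u\<^sub>D]] L2_D(2)[OF u\<^sub>D]
      by (intro Bochner_Integration.integrable_add Bochner_Integration.integrable_mult_right) auto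
    show "AE t in lebesgue. t \<notin> I \<longrightarrow> q t (u n t) \<le> ?g t"
      using step
    proof eventually_elim
      case (elim t)
      have nn: "0 \<le> \<nu>2 / 2 * (ubar t - u\<^sub>D t)\<^sup>2" "0 \<le> \<nu>2 / 2 * (u\<^sub>D t)\<^sup>2"
        "0 \<le> \<nu>2 / 2 * lam n t * (ubar t - u_opt t)\<^sup>2"
        using \<nu>2 lam[of n t] by auto
      show ?case
      proof
        assume t: "t \<notin> I"
        show "q t (u n t) \<le> ?g t"
        proof (cases "\<bar>t\<bar> \<le> real n")
          case True
          then have "indicator ?A t = (1::real)" by (auto simp: indicator_def)
          then show ?thesis using elim t nn by (simp add: control_cost_def)
        next
          case False
          then have "indicator ?A t = (0::real)" "u n t = u_opt t"
            using t by (auto simp: indicator_def u_def lam_def)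
          then show ?thesis using nn cost_u_opt_le_target[of t] by simp
        qed
      qed
    qed
  qed
  let ?gap = "\<integral>\<^sup>+ t. ennreal (\<nu>2 / 2 * lam n t * (ubar t - u_opt t)\<^sup>2) * indicator (- I) t \<partial>lebesgue"
  have "tail_cost (u n) + ?gap
      = (\<integral>\<^sup>+ t. ennreal (q t (u n t)) * indicator (- I) t
          + ennreal (\<nu>2 / 2 * lam n t * (ubar t - u_opt t)\<^sup>2) * indicator (- I) t \<partial>lebesgue)"
    unfolding tail_cost_def
    by (intro nn_integral_add[symmetric] measurable_ennreal_indicator measurable_cost L2_D(1)[OF uL]) auto
  also have "\<dots> \<le> tail_cost ubar"
    unfolding tail_cost_def
  proof (rule nn_integral_mono_AE)
    show "AE t in lebesgue. ennreal (q t (u n t)) * indicator (- I) t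
          + ennreal (\<nu>2 / 2 * lam n t * (ubar t - u_opt t)\<^sup>2) * indicator (- I) t
        \<le> ennreal (q t (ubar t)) * indicator (- I) t"
      using step
    proof eventually_elim
      case (elim t)
      have "0 \<le> \<nu>2 / 2 * lam n t * (ubar t - u_opt t)\<^sup>2" using \<nu>2 lam[of n t] by auto
      then show ?case
        using elim by (cases "t \<in> I") (auto simp: ennreal_plus[symmetric] ennreal_leI simp del: ennreal_plus)
    qed
  qed
  also note le
  finally have "tail_cost (u n) + ?gap \<le> tail_cost (u n) + 0" by simp
  then have "?gap = 0" using fin by (subst (asm) ennreal_add_left_cancel_le) auto
  moreover have "(\<lambda>t. ennreal (\<nu>2 / 2 * lam n t * (ubar t - u_opt t)\<^sup>2) * indicator (- I) t)
      \<in> borel_measurable lebesgue"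
    by (intro measurable_ennreal_indicator) auto
  ultimately have "AE t in lebesgue.
      ennreal (\<nu>2 / 2 * lam n t * (ubar t - u_opt t)\<^sup>2) * indicator (- I) t = 0"
    by (simp only: nn_integral_0_iff_AE)
  then show ?thesis
  proof eventually_elim
    case (elim t)
    show ?case
    proof
      assume t: "t \<notin> I"
      then have "lam n t > 0" by (auto simp: lam_def)
      moreover have "\<nu>2 / 2 * lam n t * (ubar t - u_opt t)\<^sup>2 \<le> 0"
        using elim t by (simp add: ennreal_eq_0_iff)
      ultimately show "ubar t = u_opt t" using \<nu>2 by (simp add: mult_le_0_iff)
    qed
  qed
qed

lemma L2norm_I_le: 
  assumes "w \<in> L2 lebesgue"
  shows "L2norm (lebesgue_on I) w \<le> L2norm lebesgue w"
  unfolding L2norm_restrict[OF I_sets]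
proof (rule L2norm_mono[OF _ _ assms])
  show "AE t in lebesgue. norm (indicator I t *\<^sub>R w t) \<le> norm (w t)"
    by (auto simp: indicator_def)
  show "(\<lambda>t. indicator I t *\<^sub>R w t) \<in> borel_measurable lebesgue"
    using L2_D(1)[OF assms] by (intro borel_measurable_scaleR borel_measurable_indicator) auto
qed

text \<open>A competitor on the interval is extended by \<open>ubar\<close>, so that the distances agree and the tail costs
  cancel; they are finite since the tail of \<open>ubar\<close> is \<open>u_opt\<close>. Conversely, restriction to the interval does not
  increase distances, and \<open>u_opt\<close> has minimal tail cost.\<close>

lemma local_solution_iff:
  assumes ubar: "ubar \<in> L2 lebesgue" and \<rho>: "0 < \<rho>"
  shows "local_solution \<rho> ubar \<longleftrightarrow>
    (AE t in lebesgue. t \<notin> I \<longrightarrow> ubar t = u_opt t) \<and>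
    local_solution_P_r \<Omega> f y\<^sub>D u\<^sub>D \<nu>1 \<nu>2 r \<rho> ubar" (is "_ \<longleftrightarrow> ?tail \<and> ?loc")
proof
  assume loc: "local_solution \<rho> ubar"
  then have adm: "admissible ubar" by (simp add: local_solution_def)
  have tail: ?tail by (rule tail_of_local_solution[OF loc \<rho>])
  have fin: "tail_cost ubar < \<infinity>" using tail_cost_cong[OF tail] tail_cost_u_opt_finite by simp
  have pos: "AE t in lebesgue. 0 \<le> ubar t" using adm by (simp add: admissible_def)
  have ?loc
    unfolding local_solution_P_r_def F_def[symmetric]
  proof (intro conjI ballI impI)
    show "ubar \<in> L2 (lebesgue_on I)" by (rule L2_restrict[OF I_sets ubar])
    show "AE t in lebesgue_on I. 0 \<le> ubar t"
      unfolding AE_lebesgue_on_iff[OF I_sets] using pos by eventually_elim simp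
    fix v
    assume v: "v \<in> L2 (lebesgue_on I)" and vpos: "AE t in lebesgue_on I. 0 \<le> v t"
      and dist: "ereal (L2norm (lebesgue_on I) (\<lambda>t. v t - ubar t)) \<le> \<rho>"
    define u where "u t = (if t \<in> I then v t else ubar t)" for t
    have "u \<in> L2 lebesgue" unfolding u_def[abs_def] by (rule L2_glue[OF I_sets v ubar])
    moreover have "AE t in lebesgue. 0 \<le> u t"
      using pos vpos unfolding AE_lebesgue_on_iff[OF I_sets] by eventually_elim (auto simp: u_def)
    ultimately have u: "admissible u" by (simp add: admissible_def)
    have "(\<lambda>t. indicator I t *\<^sub>R (v t - ubar t)) = (\<lambda>t. u t - ubar t)"
      by (auto simp: fun_eq_iff u_def indicator_def)
    then have "J ubar \<le> J u"
      using loc u dist unfolding L2norm_restrict[OF I_sets] by (simp add: local_solution_def)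
    moreover have "tail_cost u = tail_cost ubar" by (rule tail_cost_cong) (simp add: u_def)
    moreover have "F u = F v" by (rule F_cong) (simp add: u_def)
    ultimately have "tail_cost ubar + ennreal (F ubar) \<le> tail_cost ubar + ennreal (F v)"
      by (simp add: J_split[OF adm] J_split[OF u] add.commute)
    then have "ennreal (F ubar) \<le> ennreal (F v)"
      using fin by (auto simp: ennreal_add_left_cancel_le)
    then show "F ubar \<le> F v" using F_nonneg[OF vpos] by (simp add: ennreal_le_iff)
  qed
  with tail show "?tail \<and> ?loc" by simp
next
  assume "?tail \<and> ?loc"
  then have tail: ?tail and posI: "AE t in lebesgue_on I. 0 \<le> ubar t"
    and loc: "\<And>v. v \<in> L2 (lebesgue_on I) \<Longrightarrow> AE t in lebesgue_on I. 0 \<le> v t \<Longrightarrow>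
      ereal (L2norm (lebesgue_on I) (\<lambda>t. v t - ubar t)) \<le> \<rho> \<Longrightarrow> F ubar \<le> F v"
    unfolding local_solution_P_r_def F_def by auto
  have "AE t in lebesgue. 0 \<le> ubar t"
    using tail posI unfolding AE_lebesgue_on_iff[OF I_sets]
    by eventually_elim (auto simp: u_opt_nonneg)
  then have adm: "admissible ubar" using ubar by (simp add: admissible_def)
  have "J ubar \<le> J u" if u: "admissible u" and dist: "ereal (L2norm lebesgue (\<lambda>t. u t - ubar t)) \<le> \<rho>" for u
  proof -
    have uL: "u \<in> L2 lebesgue" and pos: "AE t in lebesgue. 0 \<le> u t" using u by (auto simp: admissible_def)
    have "F ubar \<le> F u"
    proof (rule loc)
      show "u \<in> L2 (lebesgue_on I)" by (rule L2_restrict[OF I_sets uL])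
      show "AE t in lebesgue_on I. 0 \<le> u t"
        unfolding AE_lebesgue_on_iff[OF I_sets] using pos by eventually_elim simp
      show "ereal (L2norm (lebesgue_on I) (\<lambda>t. u t - ubar t)) \<le> \<rho>"
        using L2norm_I_le[OF L2_diff[OF uL ubar]] dist by (meson ereal_less_eq(3) order_trans)
    qed
    moreover have "tail_cost ubar \<le> tail_cost u"
      using tail_cost_cong[OF tail] tail_cost_u_opt_le[OF pos] by simp
    ultimately show ?thesis by (simp add: J_split[OF adm] J_split[OF u] add_mono ennreal_leI)
  qed
  then show "local_solution \<rho> ubar" using adm by (simp add: local_solution_def)
qed

end

section \<open>Reduction to the bounded interval\<close>

theorem theorem4p5:
  fixes \<Omega> :: "(real ^ 'd::finite) set"
    and f y\<^sub>D y\<^sub>P :: "real ^ 'd \<Rightarrow> real"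
    and u\<^sub>D ubar :: "real \<Rightarrow> real"
    and \<nu>1 \<nu>2 r :: real
    and \<rho> :: ereal
  assumes "CARD('d) \<in> {1, 2, 3}"
    and "bounded_domain \<Omega>"
    and "convex \<Omega> \<or> C11_boundary \<Omega>"
    and "y\<^sub>D \<in> L2 (lebesgue_on \<Omega>)"
    and "u\<^sub>D \<in> L2 lebesgue"
    and "\<nu>1 \<ge> 0"
    and "\<nu>2 > 0"
    and "f \<in> L2 (lebesgue_on \<Omega>)"
    and "\<not> (AE x in lebesgue_on \<Omega>. f x = 0)"
    and "y\<^sub>P \<in> H2 \<Omega>"
    and "weak_solution \<Omega> (\<lambda>_. 0) f y\<^sub>P"
    and "ereal r \<ge> 2 * esssup (lebesgue_on \<Omega>) (\<lambda>x. ereal \<bar>y\<^sub>P x\<bar>)"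
    and "ubar \<in> L2 lebesgue"
    and "\<rho> > 0"
  shows "local_solution_P \<Omega> f y\<^sub>D u\<^sub>D \<nu>1 \<nu>2 \<rho> ubar \<longleftrightarrow>
           (AE t in lebesgue. t \<notin> {-r<..<r} \<longrightarrow> ubar t = max 0 (u\<^sub>D t - \<nu>1 / \<nu>2)) \<and>
           local_solution_P_r \<Omega> f y\<^sub>D u\<^sub>D \<nu>1 \<nu>2 r \<rho> ubar"
proof -
  have "AE x in lebesgue_on \<Omega>. 2 * \<bar>y\<^sub>P x\<bar> \<le> r"
    using esssup_AE[of "\<lambda>x. ereal \<bar>y\<^sub>P x\<bar>" "lebesgue_on \<Omega>"]
  proof eventually_elim
    case (elim x)
    then have "2 * ereal \<bar>y\<^sub>P x\<bar> \<le> 2 * esssup (lebesgue_on \<Omega>) (\<lambda>x. ereal \<bar>y\<^sub>P x\<bar>)"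
      by (rule ereal_mult_left_mono) simp
    also note assms(12)
    finally show ?case by simp
  qed
  then interpret control_problem \<Omega> f y\<^sub>D y\<^sub>P u\<^sub>D \<nu>1 \<nu>2 r
    using assms by unfold_locales
  have "local_solution_P \<Omega> f y\<^sub>D u\<^sub>D \<nu>1 \<nu>2 \<rho> ubar \<longleftrightarrow> local_solution \<rho> ubar"
    unfolding local_solution_P_def local_solution_def admissible_def J_def by blast
  then show ?thesis
    using local_solution_iff[OF assms(13,14)] by (simp add: u_opt_def)
qed

end
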